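(* Let $u$ solve $-\epsilon\Delta u+\boldsymbol\beta\cdot\nabla u+cu=f$ in $\Omega$, $u=0$ on $\partial\Omega$, with $\boldsymbol\sigma=-\epsilon^{1/2}\nabla u\in H(\mathrm{div};\Omega)$. Let $(\hat{\boldsymbol\sigma},\hat u)\in\mathcal U_1^h$ be arbitrary, and set $\hat{\mathbf E}=\boldsymbol\sigma-\hat{\boldsymbol\sigma}$ and $\hat e=u-\hat u$. Then there exist positive constants $C_{e,1}$ and $C_{r,1}$, independent of $\epsilon$, such that: - for every $K\in\mathcal T_h$, \[ \eta_K^1\le C_{e,1}\Big(M_{1,K}(\hat{\mathbf E},\hat e)+\|\boldsymbol\beta\cdot\nabla\hat e\|_K^2+\epsilon\|\nabla\cdot\hat{\mathbf E}\|_K^2\Big)^{1/2}; \] - and globally, \[ M_1(\hat{\mathbf E},\hat e)^{1/2}\le C_{r,1}\,\eta^1 . \]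
   Context: Let $\Omega\subset\mathbb R^2$ be a convex polygon. Let $0<\epsilon\le1$ and $f\in L^2(\Omega)$. Let $\boldsymbol\beta\in W^{1,\infty}(\Omega)^2$ and $c\in L^\infty(\Omega)$ with $\|c\|_{L^\infty}\le\gamma$. Assume there is $\alpha_0>0$ with $c-\tfrac12\nabla\cdot\boldsymbol\beta\ge\alpha_0$ a.e. $\mathcal T_h$ is a regular triangulation of $\Omega$. $\Sigma_h^k$ is the Raviart–Thomas space of index $k$, $V_h^{k+1}$ is the space of continuous piecewise polynomials of degree $k+1$, and $\mathcal U_1^h=(\Sigma_h^k\times V_h^{k+1})\cap(H(\mathrm{div};\Omega)\times H_0^1(\Omega))$. Local and global quantities, with $\|\cdot\|_K$ the $L^2(K)$ norm: - $M_{1,K}(\boldsymbol\tau,v)=\|\boldsymbol\tau\|_K^2+\|v\|_K^2+\epsilon\|\nabla v\|_K^2$, and $M_1=\sum_K M_{1,K}$. - $G_{1,K}(\boldsymbol\tau,v;f)=\|\boldsymbol\tau+\epsilon^{1/2}\nabla v\|_K^2+\|\epsilon^{1/2}\nabla\cdot\boldsymbol\tau+\boldsymbol\beta\cdot\nabla v+cv-f\|_K^2$. - The indicator is $\eta_K^1=G_{1,K}(\hat{\boldsymbol\sigma},\hat u;f)^{1/2}$ and the estimator is $\eta^1=\big(\sum_K(\eta_K^1)^2\big)^{1/2}$. *)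

theory Defs
  imports "HOL-Analysis.Analysis"
begin

type_synonym pt = "real^2"

definition convex_polygon :: "pt set \<Rightarrow> bool" where
  "convex_polygon \<Omega> \<longleftrightarrow> (\<exists>P. finite P \<and> \<Omega> = interior (convex hull P) \<and> \<Omega> \<noteq> {})"

definition L2 :: "pt set \<Rightarrow> (pt \<Rightarrow> 'a::euclidean_space) \<Rightarrow> bool" where
  "L2 S v \<longleftrightarrow> v \<in> borel_measurable (lebesgue_on S) \<and>
              integrable (lebesgue_on S) (\<lambda>x. (norm (v x))\<^sup>2)"

definition Linf :: "pt set \<Rightarrow> (pt \<Rightarrow> 'a::euclidean_space) \<Rightarrow> bool" where
  "Linf S v \<longleftrightarrow> v \<in> borel_measurable (lebesgue_on S) \<and>
              (\<exists>M. AE x in lebesgue_on S. norm (v x) \<le> M)"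

definition l2norm :: "pt set \<Rightarrow> (pt \<Rightarrow> 'a::euclidean_space) \<Rightarrow> real" where
  "l2norm S v = sqrt (integral\<^sup>L (lebesgue_on S) (\<lambda>x. (norm (v x))\<^sup>2))"

definition test_fun :: "pt set \<Rightarrow> (pt \<Rightarrow> real) \<Rightarrow> (pt \<Rightarrow> pt) \<Rightarrow> bool" where
  "test_fun \<Omega> \<phi> D\<phi> \<longleftrightarrow> (\<forall>x. (\<phi> has_derivative (\<lambda>h. D\<phi> x \<bullet> h)) (at x)) \<and>
     continuous_on UNIV D\<phi> \<and> compact (closure {x. \<phi> x \<noteq> 0}) \<and> closure {x. \<phi> x \<noteq> 0} \<subseteq> \<Omega>"

definition has_weak_grad :: "pt set \<Rightarrow> (pt \<Rightarrow> real) \<Rightarrow> (pt \<Rightarrow> pt) \<Rightarrow> bool" where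
  "has_weak_grad \<Omega> v g \<longleftrightarrow> (\<forall>\<phi> D\<phi>. test_fun \<Omega> \<phi> D\<phi> \<longrightarrow>
      integrable (lebesgue_on \<Omega>) (\<lambda>x. v x *\<^sub>R D\<phi> x) \<and>
      integrable (lebesgue_on \<Omega>) (\<lambda>x. \<phi> x *\<^sub>R g x) \<and>
      integral\<^sup>L (lebesgue_on \<Omega>) (\<lambda>x. v x *\<^sub>R D\<phi> x) = - integral\<^sup>L (lebesgue_on \<Omega>) (\<lambda>x. \<phi> x *\<^sub>R g x))"

definition has_weak_div :: "pt set \<Rightarrow> (pt \<Rightarrow> pt) \<Rightarrow> (pt \<Rightarrow> real) \<Rightarrow> bool" where
  "has_weak_div \<Omega> \<tau> d \<longleftrightarrow> (\<forall>\<phi> D\<phi>. test_fun \<Omega> \<phi> D\<phi> \<longrightarrow>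
      integrable (lebesgue_on \<Omega>) (\<lambda>x. \<tau> x \<bullet> D\<phi> x) \<and>
      integrable (lebesgue_on \<Omega>) (\<lambda>x. \<phi> x * d x) \<and>
      integral\<^sup>L (lebesgue_on \<Omega>) (\<lambda>x. \<tau> x \<bullet> D\<phi> x) = - integral\<^sup>L (lebesgue_on \<Omega>) (\<lambda>x. \<phi> x * d x))"

definition H10 :: "pt set \<Rightarrow> (pt \<Rightarrow> real) \<Rightarrow> (pt \<Rightarrow> pt) \<Rightarrow> bool" where
  "H10 \<Omega> v g \<longleftrightarrow> L2 \<Omega> v \<and> L2 \<Omega> g \<and> has_weak_grad \<Omega> v g \<and>
     (\<exists>\<phi> D\<phi>. (\<forall>n. test_fun \<Omega> (\<phi> n) (D\<phi> n)) \<and>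
        (\<lambda>n. l2norm \<Omega> (\<lambda>x. \<phi> n x - v x)) \<longlonglongrightarrow> 0 \<and>
        (\<lambda>n. l2norm \<Omega> (\<lambda>x. D\<phi> n x - g x)) \<longlonglongrightarrow> 0)"

definition Hdiv :: "pt set \<Rightarrow> (pt \<Rightarrow> pt) \<Rightarrow> (pt \<Rightarrow> real) \<Rightarrow> bool" where
  "Hdiv \<Omega> \<tau> d \<longleftrightarrow> L2 \<Omega> \<tau> \<and> L2 \<Omega> d \<and> has_weak_div \<Omega> \<tau> d"

definition W1inf_field :: "pt set \<Rightarrow> (pt \<Rightarrow> pt) \<Rightarrow> (2 \<Rightarrow> pt \<Rightarrow> pt) \<Rightarrow> bool" where
  "W1inf_field \<Omega> \<beta> G \<longleftrightarrow> Linf \<Omega> \<beta> \<and>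
     (\<forall>i. Linf \<Omega> (G i) \<and> has_weak_grad \<Omega> (\<lambda>x. \<beta> x $ i) (G i))"

definition div_field :: "(2 \<Rightarrow> pt \<Rightarrow> pt) \<Rightarrow> pt \<Rightarrow> real" where
  "div_field G x = (\<Sum>i\<in>UNIV. G i x $ i)"

definition weak_solution :: "pt set \<Rightarrow> real \<Rightarrow> (pt \<Rightarrow> pt) \<Rightarrow> (pt \<Rightarrow> real) \<Rightarrow> (pt \<Rightarrow> real)
      \<Rightarrow> (pt \<Rightarrow> real) \<Rightarrow> (pt \<Rightarrow> pt) \<Rightarrow> bool" where
  "weak_solution \<Omega> \<epsilon> \<beta> c f u gu \<longleftrightarrow> H10 \<Omega> u gu \<and>
     (\<forall>v gv. H10 \<Omega> v gv \<longrightarrow>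
        \<epsilon> * integral\<^sup>L (lebesgue_on \<Omega>) (\<lambda>x. gu x \<bullet> gv x)
        + integral\<^sup>L (lebesgue_on \<Omega>) (\<lambda>x. (\<beta> x \<bullet> gu x + c x * u x) * v x)
        = integral\<^sup>L (lebesgue_on \<Omega>) (\<lambda>x. f x * v x))"

definition triangle :: "pt set \<Rightarrow> bool" where
  "triangle K \<longleftrightarrow> (\<exists>a b c. \<not> collinear {a, b, c} \<and> K = convex hull {a, b, c})"

definition vertices :: "pt set \<Rightarrow> pt set" where
  "vertices K = {x. x extreme_point_of K}"

definition conf_triangulation :: "pt set \<Rightarrow> pt set set \<Rightarrow> bool" where
  "conf_triangulation \<Omega> T \<longleftrightarrow> finite T \<and> T \<noteq> {} \<and> (\<forall>K\<in>T. triangle K) \<and> \<Union>T = closure \<Omega> \<and>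
     (\<forall>K\<in>T. \<forall>K'\<in>T. K \<noteq> K' \<longrightarrow> K \<inter> K' = convex hull (vertices K \<inter> vertices K'))"

definition poly2 :: "nat \<Rightarrow> (pt \<Rightarrow> real) \<Rightarrow> bool" where
  "poly2 n p \<longleftrightarrow> (\<exists>a :: nat \<Rightarrow> nat \<Rightarrow> real.
      \<forall>x. p x = (\<Sum>i\<le>n. \<Sum>j\<le>n - i. a i j * (x $ 1) ^ i * (x $ 2) ^ j))"

definition RT :: "nat \<Rightarrow> (pt \<Rightarrow> pt) \<Rightarrow> bool" where
  "RT k \<tau> \<longleftrightarrow> (\<exists>p :: 2 \<Rightarrow> pt \<Rightarrow> real. \<exists>q. (\<forall>i. poly2 k (p i)) \<and> poly2 k q \<and>
      (\<forall>x. \<tau> x = (\<chi> i. p i x) + q x *\<^sub>R x))"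

text \<open>Broken Raviart-Thomas space (piecewise RT_k); intersected with H(div) below.\<close>
definition Sigma_h :: "pt set set \<Rightarrow> nat \<Rightarrow> (pt \<Rightarrow> pt) \<Rightarrow> bool" where
  "Sigma_h T k \<tau> \<longleftrightarrow> (\<forall>K\<in>T. \<exists>\<rho>. RT k \<rho> \<and> (\<forall>x\<in>interior K. \<tau> x = \<rho> x))"

definition V_h :: "pt set \<Rightarrow> pt set set \<Rightarrow> nat \<Rightarrow> (pt \<Rightarrow> real) \<Rightarrow> bool" where
  "V_h \<Omega> T m v \<longleftrightarrow> continuous_on (closure \<Omega>) v \<and> (\<forall>K\<in>T. \<exists>p. poly2 m p \<and> (\<forall>x\<in>K. v x = p x))"

definition U1h :: "pt set \<Rightarrow> pt set set \<Rightarrow> nat \<Rightarrow> (pt \<Rightarrow> pt) \<Rightarrow> (pt \<Rightarrow> real) \<Rightarrow> (pt \<Rightarrow> real)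
      \<Rightarrow> (pt \<Rightarrow> pt) \<Rightarrow> bool" where
  "U1h \<Omega> T k \<tau> d v g \<longleftrightarrow> Sigma_h T k \<tau> \<and> Hdiv \<Omega> \<tau> d \<and> V_h \<Omega> T (k + 1) v \<and> H10 \<Omega> v g"

text \<open>Local quantities M_{1,K} and G_{1,K}; gv is the gradient of v, d the divergence of tau.\<close>
definition M1K :: "real \<Rightarrow> pt set \<Rightarrow> (pt \<Rightarrow> pt) \<Rightarrow> (pt \<Rightarrow> real) \<Rightarrow> (pt \<Rightarrow> pt) \<Rightarrow> real" where
  "M1K \<epsilon> K \<tau> v gv = (l2norm K \<tau>)\<^sup>2 + (l2norm K v)\<^sup>2 + \<epsilon> * (l2norm K gv)\<^sup>2"

definition G1K :: "real \<Rightarrow> (pt \<Rightarrow> pt) \<Rightarrow> (pt \<Rightarrow> real) \<Rightarrow> pt set \<Rightarrow> (pt \<Rightarrow> pt) \<Rightarrow> (pt \<Rightarrow> real)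
      \<Rightarrow> (pt \<Rightarrow> real) \<Rightarrow> (pt \<Rightarrow> pt) \<Rightarrow> (pt \<Rightarrow> real) \<Rightarrow> real" where
  "G1K \<epsilon> \<beta> c K \<tau> d v gv f =
     (l2norm K (\<lambda>x. \<tau> x + sqrt \<epsilon> *\<^sub>R gv x))\<^sup>2 +
     (l2norm K (\<lambda>x. sqrt \<epsilon> * d x + \<beta> x \<bullet> gv x + c x * v x - f x))\<^sup>2"

end

theory Submission
  imports Defs
begin

text \<open>
  Testing the weak form with compactly supported functions and comparing with the weak divergence of
  \<open>- sqrt \<epsilon> \<nabla>u\<close> shows, by the fundamental lemma of the calculus of variations, that the first-order system
  holds almost everywhere. Hence the two residuals defining the estimator are, up to sign,
  \<open>A = E + sqrt \<epsilon> \<nabla>e\<close> and \<open>B = sqrt \<epsilon> div E + \<beta> \<cdot> \<nabla>e + c e\<close>. The local bound is then the triangle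
  inequality. For the global one, \<open>(A, sqrt \<epsilon> \<nabla>e) + (B, e)\<close> equals
  \<open>\<epsilon> |\<nabla>e|^2 + ((c - div \<beta> / 2) e, e)\<close>: the terms in \<open>E\<close> cancel by integration by parts, and the
  convection term is skew up to \<open>div \<beta> / 2\<close>. Cauchy-Schwarz and \<open>c - div \<beta> / 2 \<ge> \<alpha>0\<close> control \<open>e\<close>, and
  \<open>E = A - sqrt \<epsilon> \<nabla>e\<close> controls \<open>E\<close>.
\<close>

subsection \<open>Square-integrable functions\<close>

text \<open>Since \<open>H10\<close> asks for approximating C^1 test functions, each identity for an
  \<open>H10\<close> function is proved for test functions and carried over by continuity of the L2
  pairing. No trace or boundary integral appears, and the product rule is needed for C^1 functions
  only. For the same reason explicit C^1 cutoffs on boxes take the place of mollifiers in the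
  fundamental lemma. Mesh elements are closed triangles, whereas the data are controlled on the open
  domain. Passing between them costs only null sets: the frontier of a convex set and the overlaps
  of elements. Uniformity in \<epsilon>: every diffusive term keeps its weight sqrt \<epsilon>, and
  Young's inequality is used with weights 1 and \<alpha>0 only. The local bound retains the
  convective derivative of the error as a term of its own, because M_{1,K} controls the squared
  gradient only with the factor \<epsilon>, and absorbing it would cost 1/\<epsilon>.\<close>

lemma L2_integrable_inner:
  assumes "L2 S v" "L2 S w"
  shows "integrable (lebesgue_on S) (\<lambda>x. v x \<bullet> w x)"
proof -
  have [measurable]: "v \<in> borel_measurable (lebesgue_on S)" "w \<in> borel_measurable (lebesgue_on S)"
    and i: "integrable (lebesgue_on S) (\<lambda>x. (norm (v x))\<^sup>2 + (norm (w x))\<^sup>2)"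
    using assms by (auto simp: L2_def)
  show ?thesis
  proof (rule Bochner_Integration.integrable_bound[OF i])
    have "\<bar>v x \<bullet> w x\<bar> \<le> (norm (v x))\<^sup>2 + (norm (w x))\<^sup>2" for x
      using Cauchy_Schwarz_ineq2[of "v x" "w x"] sum_squares_bound[of "norm (v x)" "norm (w x)"]
        zero_le_mult_iff[of "norm (v x)" "norm (w x)"] norm_ge_zero[of "v x"] norm_ge_zero[of "w x"]
      by linarith
    then show "AE x in lebesgue_on S. norm (v x \<bullet> w x) \<le> norm ((norm (v x))\<^sup>2 + (norm (w x))\<^sup>2)"
      by (auto intro!: AE_I2)
  qed measurable
qed

lemma L2_add:
  assumes "L2 S v" "L2 S w" shows "L2 S (\<lambda>x. v x + w x)"
proof -
  have [measurable]: "v \<in> borel_measurable (lebesgue_on S)" "w \<in> borel_measurable (lebesgue_on S)"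
    and i: "integrable (lebesgue_on S) (\<lambda>x. (norm (v x))\<^sup>2 + (norm (w x))\<^sup>2 + 2 * (v x \<bullet> w x))"
    using assms L2_integrable_inner[OF assms] by (auto simp: L2_def)
  show ?thesis unfolding L2_def
    using i by (auto simp: power2_norm_eq_inner inner_add inner_commute algebra_simps)
qed

lemma L2_scaleR:
  assumes "L2 S v" shows "L2 S (\<lambda>x. k *\<^sub>R v x)"
  using assms by (auto simp: L2_def power_mult_distrib)

lemma L2_mult:
  fixes v :: "pt \<Rightarrow> real"
  assumes "L2 S v" shows "L2 S (\<lambda>x. k * v x)"
  using L2_scaleR[OF assms] by simp

lemma L2_diff:
  assumes "L2 S v" "L2 S w" shows "L2 S (\<lambda>x. v x - w x)"
  using L2_add[OF assms(1) L2_scaleR[OF assms(2), of "-1"]] by simp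

lemma l2norm_nonneg: "0 \<le> l2norm S v"
  by (simp add: l2norm_def)

lemma l2norm_sq: "(l2norm S v)\<^sup>2 = (\<integral>x. (norm (v x))\<^sup>2 \<partial>lebesgue_on S)"
  by (simp add: l2norm_def)

text \<open>Discriminant argument for the squared norm of v - t w as a quadratic in
  \<open>t\<close>. The degenerate case is separate because \<open>l2norm\<close> is only a seminorm
  on functions: norm zero does not make \<open>w\<close> the zero function.\<close>

lemma l2norm_cauchy_schwarz:
  assumes v: "L2 S v" and w: "L2 S w"
  shows "\<bar>\<integral>x. v x \<bullet> w x \<partial>lebesgue_on S\<bar> \<le> l2norm S v * l2norm S w"
proof -
  define I where "I = (\<integral>x. v x \<bullet> w x \<partial>lebesgue_on S)"
  let ?V = "(l2norm S v)\<^sup>2" and ?W = "(l2norm S w)\<^sup>2"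
  have ints: "integrable (lebesgue_on S) (\<lambda>x. (norm (v x))\<^sup>2)" "integrable (lebesgue_on S) (\<lambda>x. (norm (w x))\<^sup>2)"
    using v w by (auto simp: L2_def)
  have q: "0 \<le> ?V - 2 * t * I + t\<^sup>2 * ?W" for t
  proof -
    have "0 \<le> (\<integral>x. (norm (v x - t *\<^sub>R w x))\<^sup>2 \<partial>lebesgue_on S)" by simp
    also have "\<dots> = (\<integral>x. (norm (v x))\<^sup>2 - 2 * t * (v x \<bullet> w x) + t\<^sup>2 * (norm (w x))\<^sup>2 \<partial>lebesgue_on S)"
      by (intro Bochner_Integration.integral_cong refl)
        (simp add: power2_norm_eq_inner inner_diff inner_commute algebra_simps, simp add: power2_eq_square)
    also have "\<dots> = ?V - 2 * t * I + t\<^sup>2 * ?W"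
      using ints L2_integrable_inner[OF v w] by (simp add: l2norm_sq I_def)
    finally show ?thesis .
  qed
  have "I\<^sup>2 \<le> ?V * ?W"
  proof (cases "?W = 0")
    case True
    have "I = 0"
    proof (rule ccontr)
      assume "I \<noteq> 0"
      \<comment> \<open>With \<open>?W = 0\<close> the bound \<open>q\<close> is affine in
        \<open>t\<close>, and \<open>t = (?V + 1) / (2 * I)\<close> gives it the value -1.\<close>
      then show False
        using q[of "(?V + 1) / (2 * I)"] True by simp
    qed
    then show ?thesis by simp
  next
    case False
    then have "?W > 0" by simp
    \<comment> \<open>\<open>t = I / ?W\<close> minimises the quadratic.\<close>
    have "I\<^sup>2 / ?W \<le> ?V"
      using q[of "I / ?W"] False by (simp add: power2_eq_square)
    then show ?thesis using \<open>?W > 0\<close> by (simp only: pos_divide_le_eq)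
  qed
  then have "\<bar>I\<bar>\<^sup>2 \<le> (l2norm S v * l2norm S w)\<^sup>2" by (simp add: power_mult_distrib)
  then show ?thesis unfolding I_def by (rule power2_le_imp_le) (simp add: l2norm_nonneg)
qed

lemma l2norm_triangle:
  assumes v: "L2 S v" and w: "L2 S w"
  shows "l2norm S (\<lambda>x. v x + w x) \<le> l2norm S v + l2norm S w"
proof (rule power2_le_imp_le)
  have ints: "integrable (lebesgue_on S) (\<lambda>x. (norm (v x))\<^sup>2)" "integrable (lebesgue_on S) (\<lambda>x. (norm (w x))\<^sup>2)"
    using v w by (auto simp: L2_def)
  have "(l2norm S (\<lambda>x. v x + w x))\<^sup>2
      = (\<integral>x. (norm (v x))\<^sup>2 + 2 * (v x \<bullet> w x) + (norm (w x))\<^sup>2 \<partial>lebesgue_on S)"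
    unfolding l2norm_sq by (intro Bochner_Integration.integral_cong refl)
      (simp add: power2_norm_eq_inner inner_add inner_commute)
  also have "\<dots> = (l2norm S v)\<^sup>2 + 2 * (\<integral>x. v x \<bullet> w x \<partial>lebesgue_on S) + (l2norm S w)\<^sup>2"
    using ints L2_integrable_inner[OF v w] by (simp add: l2norm_sq)
  also have "\<dots> \<le> (l2norm S v + l2norm S w)\<^sup>2"
    using l2norm_cauchy_schwarz[OF v w] by (simp add: power2_sum)
  finally show "(l2norm S (\<lambda>x. v x + w x))\<^sup>2 \<le> (l2norm S v + l2norm S w)\<^sup>2" .
qed (simp add: l2norm_nonneg)

lemma l2norm_scaleR: "l2norm S (\<lambda>x. k *\<^sub>R v x) = \<bar>k\<bar> * l2norm S v"
  by (simp add: l2norm_def power_mult_distrib real_sqrt_mult)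

lemma l2norm_minus: "l2norm S (\<lambda>x. v x - w x) = l2norm S (\<lambda>x. w x - v x)"
  by (simp add: l2norm_def norm_minus_commute)

section \<open>Limits and bounded multipliers in L2\<close>

text \<open>Expand the pairing around the limits and apply Cauchy-Schwarz to the three terms
  containing a difference. This is the device that takes identities from test functions to
  \<open>H10\<close>.\<close>

lemma L2_inner_tendsto:
  assumes "\<And>n. L2 S (a n)" "L2 S a'" "\<And>n. L2 S (b n)" "L2 S b'"
    and A: "(\<lambda>n. l2norm S (\<lambda>x. a n x - a' x)) \<longlonglongrightarrow> 0"
    and B: "(\<lambda>n. l2norm S (\<lambda>x. b n x - b' x)) \<longlonglongrightarrow> 0"
  shows "(\<lambda>n. \<integral>x. a n x \<bullet> b n x \<partial>lebesgue_on S) \<longlonglongrightarrow> (\<integral>x. a' x \<bullet> b' x \<partial>lebesgue_on S)"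
proof -
  let ?I = "\<lambda>v w. \<integral>x. v x \<bullet> w x \<partial>lebesgue_on S"
  let ?A = "\<lambda>n. l2norm S (\<lambda>x. a n x - a' x)" and ?B = "\<lambda>n. l2norm S (\<lambda>x. b n x - b' x)"
  have "norm (?I (a n) (b n) - ?I a' b') \<le> ?A n * ?B n + ?A n * l2norm S b' + l2norm S a' * ?B n" for n
  proof -
    note La = L2_diff[OF assms(1)[of n] assms(2)] and Lb = L2_diff[OF assms(3)[of n] assms(4)]
    have "?I (a n) (b n) = (\<integral>x. (a n x - a' x) \<bullet> (b n x - b' x) + (a n x - a' x) \<bullet> b' x
        + a' x \<bullet> (b n x - b' x) + a' x \<bullet> b' x \<partial>lebesgue_on S)"
      by (intro Bochner_Integration.integral_cong refl) (simp add: inner_diff)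
    also have "\<dots> = ?I (\<lambda>x. a n x - a' x) (\<lambda>x. b n x - b' x) + ?I (\<lambda>x. a n x - a' x) b'
        + ?I a' (\<lambda>x. b n x - b' x) + ?I a' b'"
      using L2_integrable_inner[OF La Lb] L2_integrable_inner[OF La assms(4)]
        L2_integrable_inner[OF assms(2) Lb] L2_integrable_inner[OF assms(2,4)]
      by (simp del: inner_diff_left inner_diff_right)
    finally show ?thesis
      using l2norm_cauchy_schwarz[OF La Lb] l2norm_cauchy_schwarz[OF La assms(4)]
        l2norm_cauchy_schwarz[OF assms(2) Lb] by simp
  qed
  moreover have "(\<lambda>n. ?A n * ?B n + ?A n * l2norm S b' + l2norm S a' * ?B n) \<longlonglongrightarrow> 0"
    using A B by (auto intro!: tendsto_eq_intros)
  ultimately have "(\<lambda>n. ?I (a n) (b n) - ?I a' b') \<longlonglongrightarrow> 0"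
    by (rule Lim_null_comparison[OF always_eventually[OF allI]])
  then show ?thesis by (simp add: LIM_zero_iff)
qed

text \<open>The inner product lets one statement serve the vector field \<beta> and the scalar
  coefficients, where it is multiplication. \<open>M\<close> is quantified before \<open>v\<close>,
  which makes the multiplier continuous along sequences.\<close>

lemma Linf_inner_L2:
  assumes m: "Linf S m"
  shows "\<exists>M. \<forall>v. L2 S v \<longrightarrow> L2 S (\<lambda>x. m x \<bullet> v x) \<and> l2norm S (\<lambda>x. m x \<bullet> v x) \<le> M * l2norm S v"
proof -
  obtain M where M: "AE x in lebesgue_on S. norm (m x) \<le> M" and
    [measurable]: "m \<in> borel_measurable (lebesgue_on S)"
    using m by (auto simp: Linf_def)
  \<comment> \<open>\<open>M\<close> may be negative if \<open>S\<close> is null, hence the absolute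
    value.\<close>
  have bound: "AE x in lebesgue_on S. (norm (m x \<bullet> v x))\<^sup>2 \<le> \<bar>M\<bar>\<^sup>2 * (norm (v x))\<^sup>2" for v
    using M
  proof eventually_elim
    case (elim x)
    have "norm (m x \<bullet> v x) \<le> norm (m x) * norm (v x)"
      by (simp add: Cauchy_Schwarz_ineq2)
    also have "\<dots> \<le> \<bar>M\<bar> * norm (v x)" using elim by (intro mult_right_mono) auto
    finally have "(norm (m x \<bullet> v x))\<^sup>2 \<le> (\<bar>M\<bar> * norm (v x))\<^sup>2" by (intro power_mono) auto
    then show ?case by (simp add: power_mult_distrib)
  qed
  have L: "L2 S (\<lambda>x. m x \<bullet> v x)" if v: "L2 S v" for v
  proof -
    have [measurable]: "v \<in> borel_measurable (lebesgue_on S)" using v by (simp add: L2_def)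
    have i: "integrable (lebesgue_on S) (\<lambda>x. \<bar>M\<bar>\<^sup>2 * (norm (v x))\<^sup>2)" using v by (simp add: L2_def)
    have "integrable (lebesgue_on S) (\<lambda>x. (norm (m x \<bullet> v x))\<^sup>2)"
      by (rule Bochner_Integration.integrable_bound[OF i]) (use bound[of v] in simp_all)
    then show ?thesis unfolding L2_def by simp
  qed
  have "l2norm S (\<lambda>x. m x \<bullet> v x) \<le> \<bar>M\<bar> * l2norm S v" if v: "L2 S v" for v
  proof (rule power2_le_imp_le)
    have "(l2norm S (\<lambda>x. m x \<bullet> v x))\<^sup>2 \<le> (\<integral>x. \<bar>M\<bar>\<^sup>2 * (norm (v x))\<^sup>2 \<partial>lebesgue_on S)"
      unfolding l2norm_sq
      by (rule integral_mono_AE[OF _ _ bound]) (use v L[OF v] in \<open>simp_all add: L2_def\<close>)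
    then show "(l2norm S (\<lambda>x. m x \<bullet> v x))\<^sup>2 \<le> (\<bar>M\<bar> * l2norm S v)\<^sup>2"
      by (simp add: power_mult_distrib l2norm_sq)
  qed (simp add: l2norm_nonneg)
  then show ?thesis using L by blast
qed

lemma L2_inner_Linf: "Linf S m \<Longrightarrow> L2 S v \<Longrightarrow> L2 S (\<lambda>x. m x \<bullet> v x)"
  using Linf_inner_L2[of S m] by blast

lemma L2_mult_Linf:
  fixes m :: "pt \<Rightarrow> real"
  shows "Linf S m \<Longrightarrow> L2 S v \<Longrightarrow> L2 S (\<lambda>x. m x * v x)"
  using L2_inner_Linf[of S m v] by simp

lemma Linf_inner_tendsto:
  assumes m: "Linf S m" and "\<And>n. L2 S (v n)" "L2 S w"
    and lim: "(\<lambda>n. l2norm S (\<lambda>x. v n x - w x)) \<longlonglongrightarrow> 0"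
  shows "(\<lambda>n. l2norm S (\<lambda>x. m x \<bullet> v n x - m x \<bullet> w x)) \<longlonglongrightarrow> 0"
proof -
  obtain M where M: "\<And>v. L2 S v \<Longrightarrow> l2norm S (\<lambda>x. m x \<bullet> v x) \<le> M * l2norm S v"
    using Linf_inner_L2[OF m] by blast
  have "(\<lambda>n. M * l2norm S (\<lambda>x. v n x - w x)) \<longlonglongrightarrow> 0"
    using lim by (auto intro: tendsto_mult_right_zero)
  moreover have "norm (l2norm S (\<lambda>x. m x \<bullet> v n x - m x \<bullet> w x)) \<le> M * l2norm S (\<lambda>x. v n x - w x)" for n
    using M[OF L2_diff[OF assms(2)[of n] assms(3)]] by (simp add: inner_diff_right l2norm_nonneg)
  ultimately show ?thesis
    by (rule Lim_null_comparison[OF always_eventually[OF allI], rotated])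
qed

lemma l2norm_diff_tendsto:
  assumes "\<And>n. L2 S (v n)" "L2 S v'" "\<And>n. L2 S (w n)" "L2 S w'"
    and "(\<lambda>n. l2norm S (\<lambda>x. v n x - v' x)) \<longlonglongrightarrow> 0" "(\<lambda>n. l2norm S (\<lambda>x. w n x - w' x)) \<longlonglongrightarrow> 0"
  shows "(\<lambda>n. l2norm S (\<lambda>x. (v n x - w n x) - (v' x - w' x))) \<longlonglongrightarrow> 0"
proof (rule Lim_null_comparison[OF always_eventually])
  show "\<forall>n. norm (l2norm S (\<lambda>x. (v n x - w n x) - (v' x - w' x)))
      \<le> l2norm S (\<lambda>x. v n x - v' x) + l2norm S (\<lambda>x. w n x - w' x)"
  proof
    fix n
    show "norm (l2norm S (\<lambda>x. (v n x - w n x) - (v' x - w' x)))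
      \<le> l2norm S (\<lambda>x. v n x - v' x) + l2norm S (\<lambda>x. w n x - w' x)"
      using l2norm_triangle[OF L2_diff[OF assms(1)[of n] assms(2)] L2_diff[OF assms(4) assms(3)[of n]]]
      by (simp add: l2norm_minus[of S w'] algebra_simps l2norm_nonneg)
  qed
  show "(\<lambda>n. l2norm S (\<lambda>x. v n x - v' x) + l2norm S (\<lambda>x. w n x - w' x)) \<longlonglongrightarrow> 0"
    using tendsto_add[OF assms(5,6)] by simp
qed

text \<open>On a set of finite measure constants are integrable, and t \<le> 1 + t^2 supplies the
  dominating function.\<close>

lemma L2_integrable:
  assumes "S \<in> lmeasurable" "L2 S v" shows "integrable (lebesgue_on S) v"
proof -
  interpret finite_measure "lebesgue_on S" using assms(1) by (rule finite_measure_lebesgue_on)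
  have i: "integrable (lebesgue_on S) (\<lambda>x. 1 + (norm (v x))\<^sup>2)" using assms by (auto simp: L2_def)
  have "norm (v x) \<le> 1 + (norm (v x))\<^sup>2" for x
    using sum_squares_bound[of 1 "norm (v x)"] norm_ge_zero[of "v x"] unfolding power2_eq_square by linarith
  then show ?thesis
    by (intro Bochner_Integration.integrable_bound[OF i] AE_I2) (use assms in \<open>auto simp: L2_def\<close>)
qed

subsection \<open>Test functions and the space $H^1_0$\<close>

lemma test_fun_cont:
  assumes "test_fun \<Omega> \<phi> D" shows "continuous_on UNIV \<phi>" "continuous_on UNIV D"
proof -
  have "isCont \<phi> x" for x
    using assms has_derivative_continuous unfolding test_fun_def by blast
  then show "continuous_on UNIV \<phi>" by (simp add: continuous_at_imp_continuous_on)
qed (use assms in \<open>simp add: test_fun_def\<close>)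

text \<open>The complement of the closed support is open and the function vanishes on it, so
  uniqueness of the derivative forces the gradient to vanish there as well.\<close>

lemma test_fun_outside:
  assumes "test_fun \<Omega> \<phi> D" "x \<notin> closure {x. \<phi> x \<noteq> 0}" shows "\<phi> x = 0" "D x = 0"
proof -
  let ?U = "- closure {x. \<phi> x \<noteq> 0}"
  have z: "\<phi> y = 0" if "y \<in> ?U" for y
    using that closure_subset[of "{x. \<phi> x \<noteq> 0}"] by auto
  show "\<phi> x = 0" using z[of x] assms(2) by simp
  have "((\<lambda>_. 0) has_derivative (\<lambda>h. D x \<bullet> h)) (at x)"
  proof (rule has_derivative_transform_within_open)
    show "(\<phi> has_derivative (\<lambda>h. D x \<bullet> h)) (at x)" using assms(1) by (simp add: test_fun_def)
    show "open ?U" "x \<in> ?U" using assms(2) by auto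
  qed (fact z)
  then have "(\<lambda>h. D x \<bullet> h) = (\<lambda>h. 0)" using has_derivative_unique has_derivative_const by blast
  then have "D x \<bullet> D x = 0" by (rule fun_cong)
  then show "D x = 0" by simp
qed

text \<open>Continuity on the compact support, extended by zero. The absolute values in the
  witnesses cover an empty support, for which the bounds obtained may be negative.\<close>

lemma test_fun_bounded:
  assumes "test_fun \<Omega> \<phi> D"
  obtains B R where "B \<ge> 0" "R \<ge> 0" "\<And>x. norm (\<phi> x) \<le> B" "\<And>x. norm (D x) \<le> B"
    "\<And>x. norm x > R \<Longrightarrow> \<phi> x = 0"
proof -
  let ?C = "closure {x. \<phi> x \<noteq> 0}"
  have C: "compact ?C" using assms by (simp add: test_fun_def)
  have "compact (\<phi> ` ?C)" "compact (D ` ?C)"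
    by (rule compact_continuous_image[OF continuous_on_subset[OF _ subset_UNIV] C],
        rule test_fun_cont[OF assms])+
  then have "bounded (\<phi> ` ?C)" "bounded (D ` ?C)"
    using compact_imp_bounded by blast+
  then obtain b1 b2 where b: "\<forall>x\<in>?C. norm (\<phi> x) \<le> b1" "\<forall>x\<in>?C. norm (D x) \<le> b2"
    unfolding bounded_iff by blast
  obtain R where R: "\<forall>x\<in>?C. norm x \<le> R" using compact_imp_bounded[OF C] by (auto simp: bounded_iff)
  have "norm (\<phi> x) \<le> \<bar>b1\<bar> + \<bar>b2\<bar>" "norm (D x) \<le> \<bar>b1\<bar> + \<bar>b2\<bar>" for x
    using b test_fun_outside[OF assms, of x] by (cases "x \<in> ?C"; force)+
  moreover have "\<phi> x = 0" if "norm x > \<bar>R\<bar>" for x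
    using R that test_fun_outside[OF assms, of x] by (cases "x \<in> ?C") force+
  ultimately show thesis using that[of "\<bar>b1\<bar> + \<bar>b2\<bar>" "\<bar>R\<bar>"] by auto
qed

lemma test_fun_mult:
  assumes "test_fun \<Omega> \<phi> D" "test_fun \<Omega> \<psi> D'"
  shows "test_fun \<Omega> (\<lambda>x. \<phi> x * \<psi> x) (\<lambda>x. \<phi> x *\<^sub>R D' x + \<psi> x *\<^sub>R D x)"
proof -
  have sub: "closure {x. \<phi> x * \<psi> x \<noteq> 0} \<subseteq> closure {x. \<phi> x \<noteq> 0}"
    by (rule closure_mono) auto
  have "((\<lambda>x. \<phi> x * \<psi> x) has_derivative (\<lambda>h. (\<phi> x *\<^sub>R D' x + \<psi> x *\<^sub>R D x) \<bullet> h)) (at x)" for x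
  proof -
    have "(\<phi> has_derivative (\<lambda>h. D x \<bullet> h)) (at x)" "(\<psi> has_derivative (\<lambda>h. D' x \<bullet> h)) (at x)"
      using assms by (auto simp: test_fun_def)
    from has_derivative_mult[OF this] show ?thesis
      by (simp add: inner_add_left algebra_simps)
  qed
  moreover have "continuous_on UNIV (\<lambda>x. \<phi> x *\<^sub>R D' x + \<psi> x *\<^sub>R D x)"
    using test_fun_cont[OF assms(1)] test_fun_cont[OF assms(2)] by (intro continuous_intros)
  moreover have "compact (closure {x. \<phi> x * \<psi> x \<noteq> 0})"
    using compact_Int_closed[of "closure {x. \<phi> x \<noteq> 0}" "closure {x. \<phi> x * \<psi> x \<noteq> 0}"] assms(1) sub
    by (simp add: test_fun_def Int_absorb1)
  ultimately show ?thesis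
    using assms(1) sub unfolding test_fun_def by blast
qed

lemma test_fun_diff:
  assumes "test_fun \<Omega> \<phi> D" "test_fun \<Omega> \<psi> D'"
  shows "test_fun \<Omega> (\<lambda>x. \<phi> x - \<psi> x) (\<lambda>x. D x - D' x)"
proof -
  let ?C = "closure {x. \<phi> x \<noteq> 0} \<union> closure {x. \<psi> x \<noteq> 0}"
  have sub: "closure {x. \<phi> x - \<psi> x \<noteq> 0} \<subseteq> ?C"
    unfolding closure_Un[symmetric] by (rule closure_mono) auto
  have "((\<lambda>x. \<phi> x - \<psi> x) has_derivative (\<lambda>h. (D x - D' x) \<bullet> h)) (at x)" for x
    using assms by (auto simp: test_fun_def inner_diff_left intro!: has_derivative_diff)
  moreover have "continuous_on UNIV (\<lambda>x. D x - D' x)"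
    using test_fun_cont[OF assms(1)] test_fun_cont[OF assms(2)] by (intro continuous_intros)
  moreover have "compact (closure {x. \<phi> x - \<psi> x \<noteq> 0})"
    using compact_Int_closed[of ?C "closure {x. \<phi> x - \<psi> x \<noteq> 0}"] assms sub
    by (simp add: test_fun_def Int_absorb1 compact_Un)
  ultimately show ?thesis
    using assms sub unfolding test_fun_def by blast
qed

lemma continuous_L2:
  fixes v :: "pt \<Rightarrow> 'a::euclidean_space"
  assumes "S \<in> lmeasurable" "continuous_on UNIV v" "\<And>x. norm (v x) \<le> B"
  shows "L2 S v"
proof -
  interpret finite_measure "lebesgue_on S" using assms(1) by (rule finite_measure_lebesgue_on)
  have "continuous_on S v" using assms(2) continuous_on_subset by blast
  then have m[measurable]: "v \<in> borel_measurable (lebesgue_on S)"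
    using assms(1) by (auto intro: continuous_imp_measurable_on_sets_lebesgue fmeasurableD)
  moreover have "integrable (lebesgue_on S) (\<lambda>x. (norm (v x))\<^sup>2)"
    by (rule integrable_const_bound[of _ "B\<^sup>2"]) (auto intro!: AE_I2 power_mono assms(3))
  ultimately show ?thesis by (simp add: L2_def)
qed

lemma test_fun_L2:
  assumes "S \<in> lmeasurable" "test_fun \<Omega> \<phi> D" shows "L2 S \<phi>" "L2 S D"
proof -
  obtain B where "\<And>x. norm (\<phi> x) \<le> B" "\<And>x. norm (D x) \<le> B"
    using test_fun_bounded[OF assms(2)] by metis
  then show "L2 S \<phi>" "L2 S D"
    using continuous_L2[OF assms(1) test_fun_cont(1)[OF assms(2)]]
      continuous_L2[OF assms(1) test_fun_cont(2)[OF assms(2)]] by blast+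
qed

section \<open>Gradients of test functions have mean zero; test functions lie in H^1_0\<close>

text \<open>Translation invariance is applied to \<open>lborel\<close> on the whole plane. Vanishing
  off \<open>S\<close> removes the restriction, Borel measurability removes the completion.\<close>

lemma integral_lebesgue_on_eq_lborel:
  fixes g :: "pt \<Rightarrow> 'a::euclidean_space"
  assumes "S \<in> sets lebesgue" "g \<in> borel_measurable borel" "\<And>x. x \<notin> S \<Longrightarrow> g x = 0"
  shows "integral\<^sup>L (lebesgue_on S) g = integral\<^sup>L lborel g"
proof -
  have "integral\<^sup>L (lebesgue_on S) g = integral\<^sup>L lebesgue (\<lambda>x. if x \<in> S then g x else 0)"
    by (rule Lebesgue_Measure.integral_restrict_UNIV[OF assms(1), symmetric])
  also have "(\<lambda>x. if x \<in> S then g x else 0) = g" using assms(3) by auto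
  also have "integral\<^sup>L lebesgue g = integral\<^sup>L lborel g"
    using assms(2) by (intro integral_completion) simp
  finally show ?thesis .
qed

text \<open>\<open>D\<close> is the limit of difference quotients, whose integrals vanish by translation invariance.\<close>

lemma test_fun_integral_grad:
  assumes S: "\<Omega> \<in> lmeasurable" and t: "test_fun \<Omega> \<phi> D"
  shows "integral\<^sup>L (lebesgue_on \<Omega>) D = 0"
proof -
  have [measurable]: "\<phi> \<in> borel_measurable borel" "D \<in> borel_measurable borel"
    using test_fun_cont[OF t] by (auto intro: borel_measurable_continuous_onI)
  obtain B R where BR: "B \<ge> 0" "R \<ge> 0" "\<And>x. norm (\<phi> x) \<le> B" "\<And>x. norm (D x) \<le> B"
    "\<And>x. norm x > R \<Longrightarrow> \<phi> x = 0"
    using test_fun_bounded[OF t] by metis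
  have int\<phi>: "integrable lborel \<phi>"
  proof (rule Bochner_Integration.integrable_bound)
    show "integrable lborel (\<lambda>x. B * indicator (cball (0::pt) R) x :: real)"
      by (intro integrable_mult_right integrable_real_indicator emeasure_lborel_cball_finite) simp
    show "AE x in lborel. norm (\<phi> x) \<le> norm (B * indicator (cball 0 R) x :: real)"
      using BR by (intro AE_I2) (auto simp: indicator_def not_le)
  qed simp
  have key: "(\<integral>x. D x \<bullet> e \<partial>lborel) = 0" for e
  proof -
    \<comment> \<open>Difference quotient in direction \<open>e\<close> with step 1/(n+1); it tends
      pointwise to the directional derivative.\<close>
    define q where "q n x = real (Suc n) * (\<phi> (inverse (real (Suc n)) *\<^sub>R e + x) - \<phi> x)" for n x
    have q0: "integral\<^sup>L lborel (q n) = 0" for n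
    proof -
      let ?t = "inverse (real (Suc n)) *\<^sub>R e"
      have "integral\<^sup>L lborel \<phi> = (\<integral>x. \<phi> x \<partial>distr lborel borel ((+) ?t))"
        by (simp add: lborel_distr_plus)
      also have "\<dots> = (\<integral>x. \<phi> (?t + x) \<partial>lborel)" by (intro integral_distr) simp_all
      finally have eq: "(\<integral>x. \<phi> (?t + x) \<partial>lborel) = integral\<^sup>L lborel \<phi>" by simp
      have "integrable lborel (\<lambda>x. \<phi> (?t + x))"
        by (rule integrable_distr[of "(+) ?t" lborel borel]) (simp_all add: lborel_distr_plus int\<phi>)
      then show ?thesis using int\<phi> eq unfolding q_def[abs_def] by (simp del: of_nat_Suc)
    qed
    have "(\<lambda>n. integral\<^sup>L lborel (q n)) \<longlonglongrightarrow> (\<integral>x. D x \<bullet> e \<partial>lborel)"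
    proof (rule integral_dominated_convergence)
      show "(\<lambda>x. D x \<bullet> e) \<in> borel_measurable lborel" by measurable
      show "q n \<in> borel_measurable lborel" for n unfolding q_def by measurable
      \<comment> \<open>One majorant for all \<open>n\<close>: the mean value inequality bounds the
        quotient by \<open>B * norm e\<close>, and as the shift has length at most
        \<open>norm e\<close>, the quotient vanishes outside radius
        \<open>R + norm e\<close>.\<close>
      show "integrable lborel (\<lambda>x. B * norm e * indicator (cball (0::pt) (R + norm e)) x :: real)"
        by (intro integrable_mult_right integrable_real_indicator emeasure_lborel_cball_finite) simp
      show "AE x in lborel. (\<lambda>n. q n x) \<longlonglongrightarrow> D x \<bullet> e"
      proof (rule AE_I2)
        fix x
        have "((\<lambda>s. \<phi> (x + s *\<^sub>R e)) has_field_derivative (D x \<bullet> e)) (at 0)"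
        proof -
          have "(\<phi> has_derivative (\<lambda>h. D x \<bullet> h)) (at (x + 0 *\<^sub>R e))"
            using t by (simp add: test_fun_def)
          moreover have "((\<lambda>s. x + s *\<^sub>R e) has_derivative (\<lambda>s. s *\<^sub>R e)) (at 0)"
            by (auto intro!: derivative_eq_intros)
          ultimately show ?thesis unfolding has_field_derivative_def
            using has_derivative_compose[of "\<lambda>s. x + s *\<^sub>R e" "\<lambda>s. s *\<^sub>R e" 0 UNIV \<phi> "\<lambda>h. D x \<bullet> h"]
            by (simp add: mult_commute_abs)
        qed
        then have "((\<lambda>s. (\<phi> (x + s *\<^sub>R e) - \<phi> x) / s) \<longlongrightarrow> D x \<bullet> e) (at 0)"
          by (simp add: has_field_derivative_iff)
        moreover have "filterlim (\<lambda>n. inverse (real (Suc n))) (at 0) sequentially"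
          using LIMSEQ_inverse_real_of_nat by (simp add: filterlim_at)
        ultimately have "(\<lambda>n. (\<phi> (x + inverse (real (Suc n)) *\<^sub>R e) - \<phi> x) / inverse (real (Suc n))) \<longlonglongrightarrow> D x \<bullet> e"
          by (rule filterlim_compose)
        then show "(\<lambda>n. q n x) \<longlonglongrightarrow> D x \<bullet> e"
          by (simp add: q_def field_simps add.commute)
      qed
      show "AE x in lborel. norm (q n x) \<le> B * norm e * indicator (cball 0 (R + norm e)) x" for n
      proof (rule AE_I2)
        fix x
        let ?t = "inverse (real (Suc n)) *\<^sub>R e"
        have nt: "norm ?t \<le> norm e" by (simp add: field_simps)
        show "norm (q n x) \<le> B * norm e * indicator (cball 0 (R + norm e)) x"
        proof (cases "norm x \<le> R + norm e")
          case True
          have on: "onorm (\<lambda>h. D y \<bullet> h) \<le> B" for y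
            by (rule onorm_le) (metis BR(4) Cauchy_Schwarz_ineq2 mult_right_mono norm_ge_zero order_trans real_norm_def)
          have "norm (\<phi> (?t + x) - \<phi> x) \<le> B * norm (?t + x - x)"
            by (rule differentiable_bound[of UNIV \<phi> "\<lambda>y h. D y \<bullet> h"])
              (use t on in \<open>auto simp: test_fun_def\<close>)
          then have "norm (q n x) \<le> real (Suc n) * (B * norm ?t)"
            unfolding q_def norm_mult by (intro mult_mono) auto
          also have "\<dots> = B * norm e" by simp
          finally show ?thesis using True by simp
        next
          case False
          have "norm x \<le> norm (?t + x) + norm ?t"
            using norm_triangle_ineq4[of "?t + x" ?t] by simp
          with False nt have "norm (?t + x) > R" "norm x > R" by (smt (verit) norm_ge_zero)+
          then show ?thesis using BR(5) False by (simp add: q_def)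
        qed
      qed
    qed
    then show ?thesis using q0 by (simp add: LIMSEQ_const_iff)
  qed
  have D0: "D x = 0" if "x \<notin> \<Omega>" for x
    using test_fun_outside[OF t, of x] t that by (auto simp: test_fun_def)
  have eq: "integral\<^sup>L (lebesgue_on \<Omega>) D = integral\<^sup>L lborel D"
    by (rule integral_lebesgue_on_eq_lborel) (use S D0 in auto)
  \<comment> \<open>If \<open>D\<close> is integrable, \<open>key\<close> is used with
    \<open>e\<close> equal to the integral itself; otherwise the Bochner integral is 0 by its
    default value.\<close>
  show ?thesis
  proof (cases "integrable lborel D")
    case True
    then have "integral\<^sup>L lborel D \<bullet> integral\<^sup>L lborel D = 0" using key by simp
    then show ?thesis by (simp add: eq)
  next
    case False
    then show ?thesis by (simp add: eq not_integrable_integral_eq)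
  qed
qed

text \<open>Testing with \<psi> amounts to integrating the gradient of the product of \<phi> and
  \<psi>, which has mean zero. The approximating sequence is constant. This makes test functions
  admissible in \<open>weak_solution\<close>.\<close>

lemma test_fun_H10:
  assumes S: "\<Omega> \<in> lmeasurable" and t: "test_fun \<Omega> \<phi> D"
  shows "H10 \<Omega> \<phi> D"
proof -
  have "has_weak_grad \<Omega> \<phi> D"
    unfolding has_weak_grad_def
  proof (intro allI impI)
    fix \<psi> D' assume t': "test_fun \<Omega> \<psi> D'"
    \<comment> \<open>Quantified over its own pairs, since it is applied below with the two test
      functions in both orders.\<close>
    have L: "L2 \<Omega> (\<lambda>x. \<phi> x *\<^sub>R D' x)" if t: "test_fun \<Omega> \<phi> D" and t': "test_fun \<Omega> \<psi> D'" for \<phi> D \<psi> D'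
    proof -
      obtain B where B: "\<And>x. norm (\<phi> x) \<le> B" using test_fun_bounded[OF t] by metis
      obtain B' where B': "\<And>x. norm (D' x) \<le> B'" using test_fun_bounded[OF t'] by metis
      have "norm (\<phi> x *\<^sub>R D' x) \<le> B * B'" for x
        unfolding norm_scaleR real_norm_def[symmetric]
        by (intro mult_mono B B' order_trans[OF norm_ge_zero B]) simp
      moreover have "continuous_on UNIV (\<lambda>x. \<phi> x *\<^sub>R D' x)"
        using test_fun_cont[OF t] test_fun_cont[OF t'] by (intro continuous_intros)
      ultimately show ?thesis using continuous_L2[OF S] by blast
    qed
    note i = L2_integrable[OF S L[OF t t']] L2_integrable[OF S L[OF t' t]]
    have "integral\<^sup>L (lebesgue_on \<Omega>) (\<lambda>x. \<phi> x *\<^sub>R D' x + \<psi> x *\<^sub>R D x) = 0"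
      by (rule test_fun_integral_grad[OF S test_fun_mult[OF t t']])
    then show "integrable (lebesgue_on \<Omega>) (\<lambda>x. \<phi> x *\<^sub>R D' x) \<and>
       integrable (lebesgue_on \<Omega>) (\<lambda>x. \<psi> x *\<^sub>R D x) \<and>
       (LINT x|lebesgue_on \<Omega>. \<phi> x *\<^sub>R D' x) = - (LINT x|lebesgue_on \<Omega>. \<psi> x *\<^sub>R D x)"
      using i by (simp add: eq_neg_iff_add_eq_0)
  qed
  moreover have "\<exists>f Df. (\<forall>n::nat. test_fun \<Omega> (f n) (Df n)) \<and>
        (\<lambda>n. l2norm \<Omega> (\<lambda>x. f n x - \<phi> x)) \<longlonglongrightarrow> 0 \<and>
        (\<lambda>n. l2norm \<Omega> (\<lambda>x. Df n x - D x)) \<longlonglongrightarrow> 0"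
    by (rule exI[of _ "\<lambda>_. \<phi>"], rule exI[of _ "\<lambda>_. D"]) (use t in \<open>simp add: l2norm_def\<close>)
  ultimately show ?thesis using test_fun_L2[OF S t] by (simp add: H10_def)
qed

lemma has_weak_grad_diff:
  assumes "has_weak_grad \<Omega> v g" "has_weak_grad \<Omega> w h"
  shows "has_weak_grad \<Omega> (\<lambda>x. v x - w x) (\<lambda>x. g x - h x)"
  unfolding has_weak_grad_def
proof (intro allI impI)
  fix \<phi> D assume t: "test_fun \<Omega> \<phi> D"
  have "integrable (lebesgue_on \<Omega>) (\<lambda>x. v x *\<^sub>R D x)" "integrable (lebesgue_on \<Omega>) (\<lambda>x. \<phi> x *\<^sub>R g x)"
    "integral\<^sup>L (lebesgue_on \<Omega>) (\<lambda>x. v x *\<^sub>R D x) = - integral\<^sup>L (lebesgue_on \<Omega>) (\<lambda>x. \<phi> x *\<^sub>R g x)"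
    "integrable (lebesgue_on \<Omega>) (\<lambda>x. w x *\<^sub>R D x)" "integrable (lebesgue_on \<Omega>) (\<lambda>x. \<phi> x *\<^sub>R h x)"
    "integral\<^sup>L (lebesgue_on \<Omega>) (\<lambda>x. w x *\<^sub>R D x) = - integral\<^sup>L (lebesgue_on \<Omega>) (\<lambda>x. \<phi> x *\<^sub>R h x)"
    using assms t unfolding has_weak_grad_def by blast+
  then show "integrable (lebesgue_on \<Omega>) (\<lambda>x. (v x - w x) *\<^sub>R D x) \<and>
      integrable (lebesgue_on \<Omega>) (\<lambda>x. \<phi> x *\<^sub>R (g x - h x)) \<and>
      integral\<^sup>L (lebesgue_on \<Omega>) (\<lambda>x. (v x - w x) *\<^sub>R D x) = - integral\<^sup>L (lebesgue_on \<Omega>) (\<lambda>x. \<phi> x *\<^sub>R (g x - h x))"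
    by (simp add: scaleR_diff_left scaleR_diff_right)
qed

lemma has_weak_div_diff:
  assumes "has_weak_div \<Omega> v g" "has_weak_div \<Omega> w h"
  shows "has_weak_div \<Omega> (\<lambda>x. v x - w x) (\<lambda>x. g x - h x)"
  unfolding has_weak_div_def
proof (intro allI impI)
  fix \<phi> D assume t: "test_fun \<Omega> \<phi> D"
  have "integrable (lebesgue_on \<Omega>) (\<lambda>x. v x \<bullet> D x)" "integrable (lebesgue_on \<Omega>) (\<lambda>x. \<phi> x * g x)"
    "integral\<^sup>L (lebesgue_on \<Omega>) (\<lambda>x. v x \<bullet> D x) = - integral\<^sup>L (lebesgue_on \<Omega>) (\<lambda>x. \<phi> x * g x)"
    "integrable (lebesgue_on \<Omega>) (\<lambda>x. w x \<bullet> D x)" "integrable (lebesgue_on \<Omega>) (\<lambda>x. \<phi> x * h x)"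
    "integral\<^sup>L (lebesgue_on \<Omega>) (\<lambda>x. w x \<bullet> D x) = - integral\<^sup>L (lebesgue_on \<Omega>) (\<lambda>x. \<phi> x * h x)"
    using assms t unfolding has_weak_div_def by blast+
  then show "integrable (lebesgue_on \<Omega>) (\<lambda>x. (v x - w x) \<bullet> D x) \<and>
      integrable (lebesgue_on \<Omega>) (\<lambda>x. \<phi> x * (g x - h x)) \<and>
      integral\<^sup>L (lebesgue_on \<Omega>) (\<lambda>x. (v x - w x) \<bullet> D x) = - integral\<^sup>L (lebesgue_on \<Omega>) (\<lambda>x. \<phi> x * (g x - h x))"
    by (simp add: inner_diff_left right_diff_distrib)
qed

lemma Hdiv_diff:
  assumes "Hdiv \<Omega> v g" "Hdiv \<Omega> w h"
  shows "Hdiv \<Omega> (\<lambda>x. v x - w x) (\<lambda>x. g x - h x)"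
  using assms has_weak_div_diff[of \<Omega> v g w h] L2_diff[of \<Omega> v w] L2_diff[of \<Omega> g h] by (simp add: Hdiv_def)

lemma H10_diff:
  assumes S: "\<Omega> \<in> lmeasurable" and v: "H10 \<Omega> v g" and w: "H10 \<Omega> w h"
  shows "H10 \<Omega> (\<lambda>x. v x - w x) (\<lambda>x. g x - h x)"
proof -
  obtain \<phi> D where 1: "\<And>n. test_fun \<Omega> (\<phi> n) (D n)" "(\<lambda>n. l2norm \<Omega> (\<lambda>x. \<phi> n x - v x)) \<longlonglongrightarrow> 0"
    "(\<lambda>n. l2norm \<Omega> (\<lambda>x. D n x - g x)) \<longlonglongrightarrow> 0" using v by (auto simp: H10_def)
  obtain \<psi> D' where 2: "\<And>n. test_fun \<Omega> (\<psi> n) (D' n)" "(\<lambda>n. l2norm \<Omega> (\<lambda>x. \<psi> n x - w x)) \<longlonglongrightarrow> 0"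
    "(\<lambda>n. l2norm \<Omega> (\<lambda>x. D' n x - h x)) \<longlonglongrightarrow> 0" using w by (auto simp: H10_def)
  have L: "L2 \<Omega> v" "L2 \<Omega> g" "L2 \<Omega> w" "L2 \<Omega> h" using v w by (auto simp: H10_def)
  have "\<exists>f Df. (\<forall>n. test_fun \<Omega> (f n) (Df n)) \<and>
        (\<lambda>n. l2norm \<Omega> (\<lambda>x. f n x - (v x - w x))) \<longlonglongrightarrow> 0 \<and>
        (\<lambda>n. l2norm \<Omega> (\<lambda>x. Df n x - (g x - h x))) \<longlonglongrightarrow> 0"
  proof (intro exI conjI allI)
    show "test_fun \<Omega> (\<lambda>x. \<phi> n x - \<psi> n x) (\<lambda>x. D n x - D' n x)" for n
      by (rule test_fun_diff[OF 1(1) 2(1)])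
    show "(\<lambda>n. l2norm \<Omega> (\<lambda>x. \<phi> n x - \<psi> n x - (v x - w x))) \<longlonglongrightarrow> 0"
      by (rule l2norm_diff_tendsto) (use L 1 2 test_fun_L2[OF S] in blast)+
    show "(\<lambda>n. l2norm \<Omega> (\<lambda>x. D n x - D' n x - (g x - h x))) \<longlonglongrightarrow> 0"
      by (rule l2norm_diff_tendsto) (use L 1 2 test_fun_L2[OF S] in blast)+
  qed
  moreover have "has_weak_grad \<Omega> (\<lambda>x. v x - w x) (\<lambda>x. g x - h x)"
    by (rule has_weak_grad_diff) (use v w in \<open>simp_all add: H10_def\<close>)
  ultimately show ?thesis using L2_diff[OF L(1,3)] L2_diff[OF L(2,4)] unfolding H10_def by simp
qed

subsection \<open>The fundamental lemma of the calculus of variations\<close>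

text \<open>A C^1 step that is positive exactly on the positive axis and tends to 1 at infinity. C^1
  is all that \<open>test_fun\<close> demands, so a rational expression suffices.\<close>

definition ramp :: "real \<Rightarrow> real" where
  "ramp y = (max 0 y)\<^sup>2 / (1 + (max 0 y)\<^sup>2)"

definition ramp' :: "real \<Rightarrow> real" where
  "ramp' y = 2 * max 0 y / (1 + (max 0 y)\<^sup>2)\<^sup>2"

text \<open>Squaring flattens the kink at 0, where the difference quotient is at most |h| in
  size.\<close>

lemma has_real_derivative_max_sq: "((\<lambda>y. (max 0 y)\<^sup>2) has_real_derivative 2 * max 0 y) (at (y::real))"
proof -
  consider "y < 0" | "y > 0" | "y = 0" by linarith
  then show ?thesis
  proof cases
    case 1
    show ?thesis
      by (rule DERIV_cong[OF has_field_derivative_transform_within_open[of "\<lambda>_. 0" 0 _ "{..<0}"]])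
        (use 1 in auto)
  next
    case 2
    show ?thesis
      by (rule has_field_derivative_transform_within_open[of "\<lambda>y. y\<^sup>2" _ _ "{0<..}"])
        (use 2 in \<open>auto intro!: derivative_eq_intros\<close>)
  next
    case 3
    have "((\<lambda>h. (max 0 h)\<^sup>2 / h) \<longlongrightarrow> 0) (at (0::real))"
    proof (rule Lim_null_comparison)
      show "((\<lambda>h. \<bar>h\<bar>) \<longlongrightarrow> 0) (at (0::real))" by (auto intro!: tendsto_eq_intros)
      show "\<forall>\<^sub>F h in at 0. norm ((max 0 h)\<^sup>2 / h) \<le> \<bar>h\<bar>"
        by (intro always_eventually allI) (auto simp: max_def power2_eq_square)
    qed
    then show ?thesis using 3 by (simp add: has_field_derivative_iff)
  qed
qed

text \<open>Stated in chain-rule form so that \<open>derivative_eq_intros\<close> differentiates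
  \<open>bump\<close> without help.\<close>

lemma has_real_derivative_ramp [derivative_intros]:
  assumes "(f has_real_derivative f') (at x)"
  shows "((\<lambda>x. ramp (f x)) has_real_derivative ramp' (f x) * f') (at x)"
proof -
  have nz: "1 + (max 0 y)\<^sup>2 \<noteq> 0" for y :: real
    by (metis add_pos_nonneg less_irrefl zero_le_power2 zero_less_one)
  have "(ramp has_real_derivative ramp' y) (at y)" for y
    unfolding ramp_def[abs_def] ramp'_def
    by (rule DERIV_cong[OF DERIV_divide[OF has_real_derivative_max_sq
          DERIV_add[OF DERIV_const has_real_derivative_max_sq] nz]])
      (simp add: power2_eq_square algebra_simps)
  then show ?thesis using assms by (rule DERIV_chain2)
qed

lemma continuous_on_ramp' [continuous_intros]:
  "continuous_on S f \<Longrightarrow> continuous_on S (\<lambda>x. ramp' (f x))"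
proof -
  have nz: "(1 + (max 0 y)\<^sup>2)\<^sup>2 \<noteq> 0" for y :: real
    by (metis add_pos_nonneg less_irrefl zero_le_power2 zero_less_one power_not_zero)
  show "continuous_on S f \<Longrightarrow> continuous_on S (\<lambda>x. ramp' (f x))"
    unfolding ramp'_def by (intro continuous_intros ballI nz)
qed

lemma ramp_bounds: "0 \<le> ramp y" "ramp y \<le> 1"
proof -
  have "0 < 1 + (max 0 y)\<^sup>2" by (metis add_pos_nonneg zero_le_power2 zero_less_one)
  then show "0 \<le> ramp y" "ramp y \<le> 1" by (auto simp: ramp_def divide_simps)
qed

lemma ramp_eq_0: "ramp y = 0 \<longleftrightarrow> y \<le> 0"
proof -
  have "0 < 1 + (max 0 y)\<^sup>2" by (metis add_pos_nonneg zero_le_power2 zero_less_one)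
  then show ?thesis by (auto simp: ramp_def max_def)
qed

text \<open>For positive \<open>s\<close> the value is 1 - 1/(1 + (n s)^2). The limit at
  \<open>s = 0\<close> is 0, which is why open boxes arise below.\<close>

lemma ramp_scaled_tendsto: "(\<lambda>n. ramp (real n * s)) \<longlonglongrightarrow> (if s > 0 then 1 else 0)"
proof (cases "s > 0")
  case True
  have "filterlim (\<lambda>n. (real n * s)\<^sup>2) at_top sequentially"
    by (intro filterlim_pow_at_top filterlim_at_top_mult_tendsto_pos[OF tendsto_const True] filterlim_real_sequentially) simp
  then have "filterlim (\<lambda>n. 1 + (real n * s)\<^sup>2) at_top sequentially"
    by (rule filterlim_tendsto_add_at_top[OF tendsto_const])
  then have "(\<lambda>n. inverse (1 + (real n * s)\<^sup>2)) \<longlonglongrightarrow> 0"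
    by (rule tendsto_inverse_0_at_top)
  then have "(\<lambda>n. 1 - inverse (1 + (real n * s)\<^sup>2)) \<longlonglongrightarrow> 1 - 0"
    by (intro tendsto_intros)
  moreover have "ramp (real n * s) = 1 - inverse (1 + (real n * s)\<^sup>2)" for n
  proof -
    have "0 < 1 + (real n * s)\<^sup>2" by (metis add_pos_nonneg zero_le_power2 zero_less_one)
    then show ?thesis using True by (simp add: ramp_def field_simps)
  qed
  ultimately show ?thesis using True by simp
next
  case False
  then have "ramp (real n * s) = 0" for n by (simp add: ramp_eq_0 mult_nonneg_nonpos)
  then show ?thesis using False by simp
qed

text \<open>A C^1 approximation of the indicator of the open interval from \<open>a\<close> to
  \<open>b\<close>. Its support stays in the closed interval for every \<open>n\<close>; only the
  slopes at the ends steepen.\<close>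

definition bump :: "real \<Rightarrow> real \<Rightarrow> nat \<Rightarrow> real \<Rightarrow> real" where
  "bump a b n t = ramp (real n * (t - a)) * ramp (real n * (b - t))"

lemma bump_C1: "\<exists>P'. (\<forall>t. (bump a b n has_real_derivative P' t) (at t)) \<and> continuous_on UNIV P'"
proof -
  let ?P = "\<lambda>t. (ramp' (real n * (t - a)) * real n) * ramp (real n * (b - t))
    + (ramp' (real n * (b - t)) * - real n) * ramp (real n * (t - a))"
  have d: "(bump a b n has_real_derivative ?P t) (at t)" for t
    unfolding bump_def[abs_def] by (auto intro!: derivative_eq_intros)
  have r: "isCont ramp y" for y
    using DERIV_isCont[OF has_real_derivative_ramp[OF DERIV_ident, of y]] by simp
  have "continuous_on UNIV (\<lambda>t. ramp (real n * (t - c)))" "continuous_on UNIV (\<lambda>t. ramp (real n * (c - t)))" for c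
    by (auto intro!: continuous_at_imp_continuous_on isCont_o2[OF _ r] continuous_intros)
  then have "continuous_on UNIV ?P" by (intro continuous_intros)
  with d show ?thesis by (intro exI[of _ ?P] conjI allI)
qed

lemma bump_bounds: "0 \<le> bump a b n t" "bump a b n t \<le> 1"
  unfolding bump_def by (intro mult_nonneg_nonneg mult_le_one ramp_bounds)+

lemma bump_nonzero: "bump a b n t \<noteq> 0 \<Longrightarrow> a < t \<and> t < b"
proof (cases "n = 0")
  case False
  then show "bump a b n t \<noteq> 0 \<Longrightarrow> a < t \<and> t < b"
    by (auto simp: bump_def ramp_eq_0 not_le zero_less_mult_iff)
qed (simp add: bump_def ramp_def)

lemma bump_tendsto: "(\<lambda>n. bump a b n t) \<longlonglongrightarrow> (if a < t \<and> t < b then 1 else 0)"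
proof -
  have "(if a < t \<and> t < b then 1 else 0) = (if t - a > 0 then 1 else 0) * (if b - t > 0 then 1 else (0::real))"
    by simp
  then show ?thesis unfolding bump_def by (simp only:) (intro tendsto_mult ramp_scaled_tendsto)
qed

text \<open>Tensor product of two bumps. The closed box must lie in \<Omega> because it contains the
  closed support for every \<open>n\<close>.\<close>

lemma box_bump_test_fun:
  fixes a b :: pt
  assumes "cbox a b \<subseteq> \<Omega>"
  shows "\<exists>D. test_fun \<Omega> (\<lambda>x. bump (a$1) (b$1) n (x$1) * bump (a$2) (b$2) n (x$2)) D"
proof -
  let ?f = "bump (a$1) (b$1) n" and ?g = "bump (a$2) (b$2) n"
  obtain f' where f': "\<And>t. (?f has_real_derivative f' t) (at t)" "continuous_on UNIV f'"
    using bump_C1 by blast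
  obtain g' where g': "\<And>t. (?g has_real_derivative g' t) (at t)" "continuous_on UNIV g'"
    using bump_C1 by blast
  define D :: "pt \<Rightarrow> pt" where
    "D x = (f' (x$1) * ?g (x$2)) *\<^sub>R axis 1 1 + (?f (x$1) * g' (x$2)) *\<^sub>R axis 2 1" for x
  have cf: "continuous_on UNIV ?f" "continuous_on UNIV ?g"
    using f'(1) g'(1) by (auto intro: DERIV_continuous_on has_field_derivative_at_within)
  have dv: "((\<lambda>x. ?f (x$1) * ?g (x$2)) has_derivative (\<lambda>h. D x \<bullet> h)) (at x)" for x :: pt
  proof -
    have 1: "((\<lambda>x::pt. x $ i) has_derivative (\<lambda>h. h $ i)) (at x)" for i
      by (rule bounded_linear_imp_has_derivative[OF bounded_linear_vec_nth])
    have "((\<lambda>x. ?f (x$1)) has_derivative (\<lambda>h. f' (x$1) * h $ 1)) (at x)"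
      using has_derivative_compose[OF 1[of 1] f'(1)[unfolded has_field_derivative_def]] by simp
    moreover have "((\<lambda>x. ?g (x$2)) has_derivative (\<lambda>h. g' (x$2) * h $ 2)) (at x)"
      using has_derivative_compose[OF 1[of 2] g'(1)[unfolded has_field_derivative_def]] by simp
    ultimately have "((\<lambda>x. ?f (x$1) * ?g (x$2)) has_derivative
        (\<lambda>h. ?f (x$1) * (g' (x$2) * h $ 2) + (f' (x$1) * h $ 1) * ?g (x$2))) (at x)"
      by (rule has_derivative_mult)
    then show ?thesis
      by (simp add: D_def inner_add_left inner_axis' algebra_simps)
  qed
  have "continuous_on UNIV D"
    unfolding D_def
    by (intro continuous_intros continuous_on_compose2[OF cf(1)] continuous_on_compose2[OF cf(2)]
        continuous_on_compose2[OF f'(2)] continuous_on_compose2[OF g'(2)]) auto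
  moreover have sub: "closure {x::pt. ?f (x$1) * ?g (x$2) \<noteq> 0} \<subseteq> cbox a b"
    by (rule closure_minimal) (auto simp: mem_box_cart forall_2 dest!: bump_nonzero)
  moreover have "compact (closure {x::pt. ?f (x$1) * ?g (x$2) \<noteq> 0})"
    using compact_Int_closed[OF compact_cbox[of a b] closed_closure[of "{x::pt. ?f (x$1) * ?g (x$2) \<noteq> 0}"]]
    unfolding Int_absorb1[OF sub] .
  ultimately show ?thesis
    using dv assms unfolding test_fun_def by (intro exI[of _ D]) auto
qed

section \<open>From test functions to boxes, Borel sets and almost every point\<close>

text \<open>Dominated convergence along the bumps: they take values between 0 and 1, so the absolute
  value of \<open>g\<close> is a majorant.\<close>

lemma weak_zero_box_integral:
  assumes \<Omega>: "\<Omega> \<in> sets lebesgue" and g: "integrable (lebesgue_on \<Omega>) g"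
    and z: "\<And>\<phi> D. test_fun \<Omega> \<phi> D \<Longrightarrow> (\<integral>x. \<phi> x * g x \<partial>lebesgue_on \<Omega>) = 0"
    and ab: "cbox a b \<subseteq> \<Omega>"
  shows "(\<integral>x. indicat_real (box a b) x * g x \<partial>lebesgue_on \<Omega>) = 0"
proof -
  define \<phi> where "\<phi> n x = bump (a$1) (b$1) n (x$1) * bump (a$2) (b$2) n (x$2)" for n and x :: pt
  have [measurable]: "g \<in> borel_measurable (lebesgue_on \<Omega>)" using g by simp
  have t: "\<exists>D. test_fun \<Omega> (\<phi> n) D" for n
    using box_bump_test_fun[OF ab] by (simp add: \<phi>_def[abs_def])
  have "(\<lambda>n. \<integral>x. \<phi> n x * g x \<partial>lebesgue_on \<Omega>) \<longlonglongrightarrow> (\<integral>x. indicat_real (box a b) x * g x \<partial>lebesgue_on \<Omega>)"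
  proof (rule integral_dominated_convergence)
    show "integrable (lebesgue_on \<Omega>) (\<lambda>x. norm (g x))" using g by simp
    have "box a b \<in> sets (lebesgue_on \<Omega>)"
      using \<Omega> ab box_subset_cbox by (subst sets_restrict_space_iff) auto
    then show "(\<lambda>x. indicat_real (box a b) x * g x) \<in> borel_measurable (lebesgue_on \<Omega>)" by measurable
    show "(\<lambda>x. \<phi> n x * g x) \<in> borel_measurable (lebesgue_on \<Omega>)" for n
    proof -
      have "\<phi> n \<in> borel_measurable (lebesgue_on \<Omega>)"
        using t test_fun_cont(1) \<Omega> continuous_on_subset[OF _ subset_UNIV]
        by (meson continuous_imp_measurable_on_sets_lebesgue)
      then show ?thesis by measurable
    qed
    show "AE x in lebesgue_on \<Omega>. (\<lambda>n. \<phi> n x * g x) \<longlonglongrightarrow> indicat_real (box a b) x * g x"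
    proof (rule AE_I2)
      fix x
      have "(\<lambda>n. \<phi> n x) \<longlonglongrightarrow> indicat_real (box a b) x"
        unfolding \<phi>_def
        using tendsto_mult[OF bump_tendsto[of "a$1" "b$1" "x$1"] bump_tendsto[of "a$2" "b$2" "x$2"]]
        by (auto simp: indicator_def mem_box_cart forall_2 split: if_splits)
      then show "(\<lambda>n. \<phi> n x * g x) \<longlonglongrightarrow> indicat_real (box a b) x * g x"
        by (intro tendsto_intros)
    qed
    show "AE x in lebesgue_on \<Omega>. norm (\<phi> n x * g x) \<le> norm (g x)" for n
      by (rule AE_I2) (auto simp: \<phi>_def abs_mult bump_bounds intro!: mult_left_le_one_le mult_le_one mult_nonneg_nonneg)
  qed
  moreover have "(\<integral>x. \<phi> n x * g x \<partial>lebesgue_on \<Omega>) = 0" for n using t z by blast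
  ultimately show ?thesis by (simp add: LIMSEQ_const_iff)
qed

text \<open>Dynkin's argument: open boxes are stable under intersection and generate the Borel sets,
  and the sets \<open>A\<close> with the asserted property form a Dynkin system. Intersecting with a
  fixed box whose closure lies in \<Omega> keeps every generating box within reach of the previous
  lemma.\<close>

lemma weak_zero_borel_integral:
  assumes \<Omega>: "\<Omega> \<in> sets lebesgue" and g: "integrable (lebesgue_on \<Omega>) g"
    and z: "\<And>\<phi> D. test_fun \<Omega> \<phi> D \<Longrightarrow> (\<integral>x. \<phi> x * g x \<partial>lebesgue_on \<Omega>) = 0"
    and ab: "cbox a b \<subseteq> \<Omega>" and A: "A \<in> sets borel"
  shows "(LINT x:A \<inter> box a b|lebesgue_on \<Omega>. g x) = 0"
proof -
  let ?E = "range (\<lambda>(a, b). box a b :: pt set)" and ?M = "lebesgue_on \<Omega>"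
  have box: "(LINT x:box c d|?M. g x) = 0" if "cbox c d \<subseteq> \<Omega>" for c d
    using weak_zero_box_integral[OF \<Omega> g z that] by (simp add: set_lebesgue_integral_def)
  have st: "Int_stable ?E"
    by (auto simp: Int_stable_def box_Int_box)
  have m: "X \<inter> box a b \<in> sets ?M" if "X \<in> sets borel" for X
    using \<Omega> ab that box_subset_cbox[of a b] by (subst sets_restrict_space_iff) auto
  have i: "set_integrable ?M X g" if "X \<in> sets ?M" for X
    unfolding set_integrable_def using that g by (rule integrable_mult_indicator)
  have sb: "sets borel = sigma_sets UNIV ?E" by (subst borel_eq_box) simp
  have sub: "?E \<subseteq> Pow UNIV" by simp
  from st sub A[unfolded sb] show ?thesis
  proof (induction rule: sigma_sets_induct_disjoint)
    case (basic A)
    then obtain c d where "A = box c d" by auto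
    then obtain c d where cd: "A \<inter> box a b = box c d" by (auto simp: box_Int_box)
    \<comment> \<open>The closure of an open box is the corresponding \<open>cbox\<close> only if
      the open box is nonempty: an empty \<open>box\<close> can have a nonempty
      \<open>cbox\<close>.\<close>
    show ?case
    proof (cases "box c d = {}")
      case True then show ?thesis by (simp add: cd set_lebesgue_integral_def)
    next
      case False
      have "closure (box c d) \<subseteq> cbox a b"
        using cd box_subset_cbox[of a b] by (intro closure_minimal) auto
      then show ?thesis using False ab box[of c d] by (simp add: cd)
    qed
  next
    case empty then show ?case by (simp add: set_lebesgue_integral_def)
  next
    case (compl A)
    then have A: "A \<in> sets borel" by (simp add: sb)
    have "(LINT x:(A \<inter> box a b) \<union> ((UNIV - A) \<inter> box a b)|?M. g x)
      = (LINT x:A \<inter> box a b|?M. g x) + (LINT x:(UNIV - A) \<inter> box a b|?M. g x)"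
      by (rule set_integral_Un) (use A in \<open>auto intro!: i m\<close>)
    moreover have "(A \<inter> box a b) \<union> ((UNIV - A) \<inter> box a b) = box a b" by auto
    ultimately show ?case using compl box[OF ab] by simp
  next
    case (union A)
    then have A: "A i \<in> sets borel" for i by (auto simp: sb)
    have eq: "(\<Union>i. A i) \<inter> box a b = (\<Union>i. A i \<inter> box a b)" by auto
    have "(LINT x:(\<Union>i. A i \<inter> box a b)|?M. g x) = (\<Sum>i. (LINT x:(A i \<inter> box a b)|?M. g x))"
    proof (rule lebesgue_integral_countable_add)
      show "A i \<inter> box a b \<inter> (A j \<inter> box a b) = {}" if "i \<noteq> j" for i j
        using that union by (auto simp: disjoint_family_on_def)
      show "set_integrable ?M (\<Union>i. A i \<inter> box a b) g"
        by (intro i sets.countable_UN image_subsetI m A) 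
    qed (intro m A)
    also have "\<dots> = 0" by (simp add: union.IH)
    finally show ?case unfolding eq .
  qed
qed

text \<open>On each closed box inside \<Omega>, vanishing integrals over all measurable sets force
  \<open>g\<close> to vanish almost everywhere. An open set is a countable union of closed boxes, so
  the exceptional null sets can be collected.\<close>

lemma fundamental_lemma_variations:
  assumes \<Omega>: "open \<Omega>" and g: "integrable (lebesgue_on \<Omega>) g"
    and z: "\<And>\<phi> D. test_fun \<Omega> \<phi> D \<Longrightarrow> (\<integral>x. \<phi> x * g x \<partial>lebesgue_on \<Omega>) = 0"
  shows "AE x in lebesgue_on \<Omega>. g x = 0"
proof -
  have \<Omega>m: "\<Omega> \<in> sets lebesgue" using \<Omega> by auto
  have box: "AE x in lebesgue. x \<in> \<Omega> \<longrightarrow> x \<in> cbox a b \<longrightarrow> g x = 0" if ab: "cbox a b \<subseteq> \<Omega>" for a b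
  proof -
    let ?M = "lebesgue_on \<Omega>"
    have Bm: "box a b \<in> sets ?M"
      using \<Omega>m ab box_subset_cbox by (subst sets_restrict_space_iff) auto
    have "AE x in ?M. indicat_real (box a b) x *\<^sub>R g x = 0"
    proof (rule density_unique_real)
      show "integrable ?M (\<lambda>x. indicat_real (box a b) x *\<^sub>R g x)"
        using Bm g by (rule integrable_mult_indicator)
      show "integrable ?M (\<lambda>x. 0 :: real)" by simp
      fix A assume A: "A \<in> sets ?M"
      then have "A \<in> sets lebesgue" using \<Omega>m by (subst (asm) sets_restrict_space_iff) auto
      \<comment> \<open>A Lebesgue measurable set is a Borel set up to a null set; only the Borel
        part is covered by \<open>weak_zero_borel_integral\<close>.\<close>
      then obtain S N N' where N: "A = S \<union> N" "N \<subseteq> N'" "N' \<in> null_sets lborel" "S \<in> sets lborel"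
        by (rule sets_completionE)
      have "N' \<in> null_sets lebesgue" using N(3) by (rule null_sets_completionI)
      then have ae: "AE x in ?M. x \<notin> N'"
        using \<Omega>m by (subst AE_restrict_space_iff) (auto intro: AE_mp[OF AE_not_in])
      have Sm: "S \<inter> box a b \<in> sets ?M"
        using \<Omega>m ab N(4) box_subset_cbox[of a b] by (subst sets_restrict_space_iff) auto
      have "(LINT x:A|?M. indicat_real (box a b) x *\<^sub>R g x) = (LINT x:S \<inter> box a b|?M. g x)"
        unfolding set_lebesgue_integral_def
      proof (rule integral_cong_AE)
        show "(\<lambda>x. indicat_real A x *\<^sub>R indicat_real (box a b) x *\<^sub>R g x) \<in> borel_measurable ?M"
          using A Bm g by measurable
        show "(\<lambda>x. indicat_real (S \<inter> box a b) x *\<^sub>R g x) \<in> borel_measurable ?M"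
          using Sm g by measurable
        show "AE x in ?M. indicat_real A x *\<^sub>R indicat_real (box a b) x *\<^sub>R g x = indicat_real (S \<inter> box a b) x *\<^sub>R g x"
          using ae by eventually_elim (use N in \<open>auto simp: indicator_def\<close>)
      qed
      also have "\<dots> = 0" by (rule weak_zero_borel_integral[OF \<Omega>m g z ab]) (use N in auto)
      finally show "(LINT x:A|?M. indicat_real (box a b) x *\<^sub>R g x) = (LINT x:A|?M. 0)" by simp
    qed
    then have "AE x in lebesgue. x \<in> \<Omega> \<longrightarrow> indicat_real (box a b) x *\<^sub>R g x = 0"
      using \<Omega>m by (subst (asm) AE_restrict_space_iff) auto
    \<comment> \<open>The bumps yield the open box, the countable cover uses closed ones; the faces
      in between are null.\<close>
    moreover have "AE x in lebesgue. x \<notin> cbox a b - box a b"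
      using negligible_frontier_interval[of a b] by (intro AE_not_in, simp only: negligible_iff_null_sets)
    ultimately show ?thesis by eventually_elim (auto simp: indicator_def)
  qed
  obtain \<D> where \<D>: "countable \<D>" "\<D> \<subseteq> Pow \<Omega>" "\<And>X. X \<in> \<D> \<Longrightarrow> \<exists>a b. X = cbox a b" "\<Union>\<D> = \<Omega>"
    using open_countable_Union_open_cbox[OF \<Omega>] by metis
  have "AE x in lebesgue. \<forall>X\<in>\<D>. x \<in> \<Omega> \<longrightarrow> x \<in> X \<longrightarrow> g x = 0"
    using \<D>(1)
  proof (rule AE_ball_countable[THEN iffD2], intro ballI)
    fix X assume X: "X \<in> \<D>"
    then obtain a b where "X = cbox a b" using \<D>(3) by blast
    then show "AE x in lebesgue. x \<in> \<Omega> \<longrightarrow> x \<in> X \<longrightarrow> g x = 0" using box[of a b] X \<D>(2) by blast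
  qed
  then have "AE x in lebesgue. x \<in> \<Omega> \<longrightarrow> g x = 0"
    by eventually_elim (use \<D>(4) in blast)
  then show ?thesis using \<Omega>m by (subst AE_restrict_space_iff) auto
qed

subsection \<open>Integration by parts and the strong form of the equation\<close>

lemma H10_approx:
  assumes \<Omega>: "\<Omega> \<in> lmeasurable" and v: "H10 \<Omega> v g"
  obtains \<phi> D where "\<And>n. test_fun \<Omega> (\<phi> n) (D n)" "\<And>n. L2 \<Omega> (\<phi> n)" "\<And>n. L2 \<Omega> (D n)"
    "(\<lambda>n. l2norm \<Omega> (\<lambda>x. \<phi> n x - v x)) \<longlonglongrightarrow> 0" "(\<lambda>n. l2norm \<Omega> (\<lambda>x. D n x - g x)) \<longlonglongrightarrow> 0"
proof -
  obtain \<phi> D where 1: "\<And>n. test_fun \<Omega> (\<phi> n) (D n)" "(\<lambda>n. l2norm \<Omega> (\<lambda>x. \<phi> n x - v x)) \<longlonglongrightarrow> 0"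
    "(\<lambda>n. l2norm \<Omega> (\<lambda>x. D n x - g x)) \<longlonglongrightarrow> 0" using v by (auto simp: H10_def)
  show thesis by (rule that[OF 1(1) test_fun_L2(1)[OF \<Omega> 1(1)] test_fun_L2(2)[OF \<Omega> 1(1)] 1(2,3)])
qed

text \<open>For test functions this is the definition of the weak divergence, and both sides are
  L2-continuous in the \<open>H10\<close> function and its gradient. No boundary term can arise, as
  the approximants have compact support in \<Omega>.\<close>

lemma Hdiv_H10_integration_by_parts:
  assumes \<Omega>: "\<Omega> \<in> lmeasurable" and \<tau>: "Hdiv \<Omega> \<tau> d" and v: "H10 \<Omega> v g"
  shows "(\<integral>x. \<tau> x \<bullet> g x \<partial>lebesgue_on \<Omega>) = - (\<integral>x. d x * v x \<partial>lebesgue_on \<Omega>)"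
proof -
  obtain \<phi> D where 1: "\<And>n. test_fun \<Omega> (\<phi> n) (D n)" and L: "\<And>n. L2 \<Omega> (\<phi> n)" "\<And>n. L2 \<Omega> (D n)"
    and c: "(\<lambda>n. l2norm \<Omega> (\<lambda>x. \<phi> n x - v x)) \<longlonglongrightarrow> 0" "(\<lambda>n. l2norm \<Omega> (\<lambda>x. D n x - g x)) \<longlonglongrightarrow> 0"
    by (rule H10_approx[OF \<Omega> v]) (rule that)
  have L': "L2 \<Omega> \<tau>" "L2 \<Omega> d" "L2 \<Omega> v" "L2 \<Omega> g" using \<tau> v by (auto simp: Hdiv_def H10_def)
  \<comment> \<open>The fixed factors \<tau> and \<open>d\<close> enter the limit lemma as constant
    sequences.\<close>
  have z: "(\<lambda>n. l2norm \<Omega> (\<lambda>x. w x - w x)) \<longlonglongrightarrow> 0" for w :: "pt \<Rightarrow> 'b::euclidean_space"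
    by (simp add: l2norm_def)
  have "(\<lambda>n. \<integral>x. \<tau> x \<bullet> D n x \<partial>lebesgue_on \<Omega>) \<longlonglongrightarrow> (\<integral>x. \<tau> x \<bullet> g x \<partial>lebesgue_on \<Omega>)"
    by (rule L2_inner_tendsto[OF L'(1) L'(1) L(2) L'(4) z c(2)])
  moreover have "(\<lambda>n. - (\<integral>x. d x \<bullet> \<phi> n x \<partial>lebesgue_on \<Omega>)) \<longlonglongrightarrow> - (\<integral>x. d x \<bullet> v x \<partial>lebesgue_on \<Omega>)"
    by (intro tendsto_minus L2_inner_tendsto[OF L'(2) L'(2) L(1) L'(3) z c(1)])
  moreover have "(\<integral>x. \<tau> x \<bullet> D n x \<partial>lebesgue_on \<Omega>) = - (\<integral>x. d x \<bullet> \<phi> n x \<partial>lebesgue_on \<Omega>)" for n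
    using \<tau> 1[of n] unfolding Hdiv_def has_weak_div_def by (simp add: mult.commute)
  ultimately show ?thesis using LIMSEQ_unique by fastforce
qed

lemma Linf_div_field:
  assumes "W1inf_field \<Omega> \<beta> G" shows "Linf \<Omega> (div_field G)"
proof -
  have G: "Linf \<Omega> (G 1)" "Linf \<Omega> (G 2)" using assms by (auto simp: W1inf_field_def)
  then obtain M N where "AE x in lebesgue_on \<Omega>. norm (G 1 x) \<le> M" "AE x in lebesgue_on \<Omega>. norm (G 2 x) \<le> N"
    by (auto simp: Linf_def)
  then have "AE x in lebesgue_on \<Omega>. norm (div_field G x) \<le> M + N"
  proof eventually_elim
    case (elim x)
    then show ?case
      using component_le_norm_cart[of "G 1 x" 1] component_le_norm_cart[of "G 2 x" 2]
      by (simp add: div_field_def sum_2)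
  qed
  moreover have "div_field G \<in> borel_measurable (lebesgue_on \<Omega>)"
  proof -
    have [measurable]: "G i \<in> borel_measurable (lebesgue_on \<Omega>)" for i
      using assms by (auto simp: W1inf_field_def Linf_def)
    have "(\<lambda>x. G i x \<bullet> axis i 1) \<in> borel_measurable (lebesgue_on \<Omega>)" for i by measurable
    then have "(\<lambda>x. G i x $ i) \<in> borel_measurable (lebesgue_on \<Omega>)" for i by (simp add: inner_axis)
    then show ?thesis unfolding div_field_def[abs_def] by measurable
  qed
  ultimately show ?thesis by (auto simp: Linf_def)
qed

text \<open>The square of a test function is a test function with gradient 2 \<phi> D. Testing the
  weak gradient of the i-th component of \<beta> with it, taking the i-th coordinate and summing
  over i gives the claim.\<close>

lemma convection_test_fun:
  assumes \<beta>: "W1inf_field \<Omega> \<beta> G" and t: "test_fun \<Omega> \<phi> D"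
  shows "2 * (\<integral>x. (\<beta> x \<bullet> D x) * \<phi> x \<partial>lebesgue_on \<Omega>) = - (\<integral>x. (div_field G x * \<phi> x) * \<phi> x \<partial>lebesgue_on \<Omega>)"
proof -
  let ?M = "lebesgue_on \<Omega>"
  have t2: "test_fun \<Omega> (\<lambda>x. \<phi> x * \<phi> x) (\<lambda>x. \<phi> x *\<^sub>R D x + \<phi> x *\<^sub>R D x)"
    by (rule test_fun_mult[OF t t])
  have i: "integrable ?M (\<lambda>x. \<beta> x $ i *\<^sub>R (\<phi> x *\<^sub>R D x + \<phi> x *\<^sub>R D x))"
    "integrable ?M (\<lambda>x. (\<phi> x * \<phi> x) *\<^sub>R G i x)"
    "integral\<^sup>L ?M (\<lambda>x. \<beta> x $ i *\<^sub>R (\<phi> x *\<^sub>R D x + \<phi> x *\<^sub>R D x)) = - integral\<^sup>L ?M (\<lambda>x. (\<phi> x * \<phi> x) *\<^sub>R G i x)" for i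
    using \<beta> t2 unfolding W1inf_field_def has_weak_grad_def by blast+
  have ic: "integrable ?M (\<lambda>x. (\<beta> x $ i *\<^sub>R (\<phi> x *\<^sub>R D x + \<phi> x *\<^sub>R D x)) $ i)"
    "integrable ?M (\<lambda>x. ((\<phi> x * \<phi> x) *\<^sub>R G i x) $ i)"
    "integral\<^sup>L ?M (\<lambda>x. (\<beta> x $ i *\<^sub>R (\<phi> x *\<^sub>R D x + \<phi> x *\<^sub>R D x)) $ i) = - integral\<^sup>L ?M (\<lambda>x. ((\<phi> x * \<phi> x) *\<^sub>R G i x) $ i)" for i
  proof -
    show "integrable ?M (\<lambda>x. (\<beta> x $ i *\<^sub>R (\<phi> x *\<^sub>R D x + \<phi> x *\<^sub>R D x)) $ i)"
      by (rule integrable_bounded_linear[OF bounded_linear_vec_nth i(1)])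
    show "integrable ?M (\<lambda>x. ((\<phi> x * \<phi> x) *\<^sub>R G i x) $ i)"
      by (rule integrable_bounded_linear[OF bounded_linear_vec_nth i(2)])
    show "integral\<^sup>L ?M (\<lambda>x. (\<beta> x $ i *\<^sub>R (\<phi> x *\<^sub>R D x + \<phi> x *\<^sub>R D x)) $ i) = - integral\<^sup>L ?M (\<lambda>x. ((\<phi> x * \<phi> x) *\<^sub>R G i x) $ i)"
      unfolding integral_bounded_linear[OF bounded_linear_vec_nth i(1)] integral_bounded_linear[OF bounded_linear_vec_nth i(2)] i(3)
      by (rule vector_uminus_component)
  qed
  have "2 * (\<integral>x. (\<beta> x \<bullet> D x) * \<phi> x \<partial>?M) = (\<integral>x. (\<Sum>i\<in>UNIV. (\<beta> x $ i *\<^sub>R (\<phi> x *\<^sub>R D x + \<phi> x *\<^sub>R D x)) $ i) \<partial>?M)"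
    unfolding integral_mult_right_zero[symmetric]
    by (intro Bochner_Integration.integral_cong refl) (simp add: inner_vec_def sum_2 algebra_simps)
  also have "\<dots> = (\<Sum>i\<in>UNIV. - integral\<^sup>L ?M (\<lambda>x. ((\<phi> x * \<phi> x) *\<^sub>R G i x) $ i))"
    using ic(1,3) by (subst Bochner_Integration.integral_sum) (auto simp del: vector_scaleR_component vector_add_component)
  also have "\<dots> = - (\<integral>x. (\<Sum>i\<in>UNIV. ((\<phi> x * \<phi> x) *\<^sub>R G i x) $ i) \<partial>?M)"
    using ic(2) by (subst Bochner_Integration.integral_sum) (auto simp: sum_negf simp del: vector_scaleR_component)
  also have "(\<integral>x. (\<Sum>i\<in>UNIV. ((\<phi> x * \<phi> x) *\<^sub>R G i x) $ i) \<partial>?M) = (\<integral>x. (div_field G x * \<phi> x) * \<phi> x \<partial>?M)"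
    by (intro Bochner_Integration.integral_cong refl) (simp add: div_field_def sum_2 algebra_simps)
  finally show ?thesis .
qed

text \<open>Both sides are L2-continuous, since \<beta> and its divergence act as bounded
  multipliers. Working with test functions first avoids a product rule for \<beta> and
  \<open>v\<close>.\<close>

lemma convection_skew:
  assumes \<Omega>: "\<Omega> \<in> lmeasurable" and \<beta>: "W1inf_field \<Omega> \<beta> G" and v: "H10 \<Omega> v g"
  shows "2 * (\<integral>x. (\<beta> x \<bullet> g x) * v x \<partial>lebesgue_on \<Omega>) = - (\<integral>x. (div_field G x * v x) * v x \<partial>lebesgue_on \<Omega>)"
proof -
  obtain \<phi> D where 1: "\<And>n. test_fun \<Omega> (\<phi> n) (D n)" and L: "\<And>n. L2 \<Omega> (\<phi> n)" "\<And>n. L2 \<Omega> (D n)"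
    and c: "(\<lambda>n. l2norm \<Omega> (\<lambda>x. \<phi> n x - v x)) \<longlonglongrightarrow> 0" "(\<lambda>n. l2norm \<Omega> (\<lambda>x. D n x - g x)) \<longlonglongrightarrow> 0"
    by (rule H10_approx[OF \<Omega> v]) (rule that)
  have L': "L2 \<Omega> v" "L2 \<Omega> g" using v by (auto simp: H10_def)
  have b: "Linf \<Omega> \<beta>" using \<beta> by (simp add: W1inf_field_def)
  note d = Linf_div_field[OF \<beta>]
  \<comment> \<open>Products of reals are written as inner products to fit
    \<open>L2_inner_tendsto\<close>.\<close>
  have h1: "(\<lambda>n. 2 * (\<integral>x. (\<beta> x \<bullet> D n x) \<bullet> \<phi> n x \<partial>lebesgue_on \<Omega>)) \<longlonglongrightarrow> 2 * (\<integral>x. (\<beta> x \<bullet> g x) \<bullet> v x \<partial>lebesgue_on \<Omega>)"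
    by (intro tendsto_mult tendsto_const L2_inner_tendsto L2_inner_Linf[OF b] L L' c Linf_inner_tendsto[OF b])
  have h2: "(\<lambda>n. - (\<integral>x. (div_field G x \<bullet> \<phi> n x) \<bullet> \<phi> n x \<partial>lebesgue_on \<Omega>)) \<longlonglongrightarrow> - (\<integral>x. (div_field G x \<bullet> v x) \<bullet> v x \<partial>lebesgue_on \<Omega>)"
    by (intro tendsto_minus L2_inner_tendsto L2_inner_Linf[OF d] L L' c Linf_inner_tendsto[OF d])
  have eq: "2 * (\<integral>x. (\<beta> x \<bullet> D n x) \<bullet> \<phi> n x \<partial>lebesgue_on \<Omega>) = - (\<integral>x. (div_field G x \<bullet> \<phi> n x) \<bullet> \<phi> n x \<partial>lebesgue_on \<Omega>)" for n
    using convection_test_fun[OF \<beta> 1[of n]] by simp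
  from LIMSEQ_unique[OF h1[unfolded eq] h2] show ?thesis by simp
qed

text \<open>Second derivatives of \<open>u\<close> never occur: the flux already has a weak
  divergence \<open>d\<close>, so the diffusion term turns into a pairing of \<open>d\<close> with
  the test function. One factor sqrt \<epsilon> sits in the flux, the other remains in front of
  \<open>d\<close>.\<close>

lemma weak_solution_strong:
  assumes \<Omega>: "\<Omega> \<in> lmeasurable" "open \<Omega>" and \<beta>: "Linf \<Omega> \<beta>" and c: "Linf \<Omega> c" and f: "L2 \<Omega> f"
    and \<epsilon>: "0 < \<epsilon>" and sol: "weak_solution \<Omega> \<epsilon> \<beta> c f u gu"
    and \<sigma>: "Hdiv \<Omega> (\<lambda>x. - sqrt \<epsilon> *\<^sub>R gu x) d"
  shows "AE x in lebesgue_on \<Omega>. sqrt \<epsilon> * d x + \<beta> x \<bullet> gu x + c x * u x - f x = 0"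
proof (rule fundamental_lemma_variations[OF \<Omega>(2)])
  let ?M = "lebesgue_on \<Omega>"
  have L: "L2 \<Omega> u" "L2 \<Omega> gu" "L2 \<Omega> d" using sol \<sigma> by (auto simp: weak_solution_def H10_def Hdiv_def)
  have L1: "L2 \<Omega> (\<lambda>x. \<beta> x \<bullet> gu x + c x * u x)"
    by (intro L2_add L2_inner_Linf L2_mult_Linf \<beta> c L)
  have "L2 \<Omega> (\<lambda>x. sqrt \<epsilon> * d x + (\<beta> x \<bullet> gu x + c x * u x) - f x)"
    by (intro L2_diff L2_add[of \<Omega> "\<lambda>x. sqrt \<epsilon> * d x"] L2_mult L1 L f)
  then show "integrable ?M (\<lambda>x. sqrt \<epsilon> * d x + \<beta> x \<bullet> gu x + c x * u x - f x)"
    using L2_integrable[OF \<Omega>(1)] by (simp add: add.assoc)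
  fix \<phi> D assume t: "test_fun \<Omega> \<phi> D"
  note P = test_fun_L2[OF \<Omega>(1) t]
  have 1: "\<epsilon> * (\<integral>x. gu x \<bullet> D x \<partial>?M) + (\<integral>x. (\<beta> x \<bullet> gu x + c x * u x) * \<phi> x \<partial>?M) = (\<integral>x. f x * \<phi> x \<partial>?M)"
    using sol test_fun_H10[OF \<Omega>(1) t] by (simp add: weak_solution_def)
  have "(\<integral>x. (- sqrt \<epsilon> *\<^sub>R gu x) \<bullet> D x \<partial>?M) = - (\<integral>x. d x * \<phi> x \<partial>?M)"
    by (rule Hdiv_H10_integration_by_parts[OF \<Omega>(1) \<sigma> test_fun_H10[OF \<Omega>(1) t]])
  then have "sqrt \<epsilon> * (\<integral>x. gu x \<bullet> D x \<partial>?M) = (\<integral>x. d x * \<phi> x \<partial>?M)" by simp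
  then have "sqrt \<epsilon> * (sqrt \<epsilon> * (\<integral>x. gu x \<bullet> D x \<partial>?M)) = sqrt \<epsilon> * (\<integral>x. d x * \<phi> x \<partial>?M)" by simp
  then have 2: "\<epsilon> * (\<integral>x. gu x \<bullet> D x \<partial>?M) = sqrt \<epsilon> * (\<integral>x. d x * \<phi> x \<partial>?M)"
    using \<epsilon> by (simp add: mult.assoc[symmetric])
  have "(\<integral>x. \<phi> x * (sqrt \<epsilon> * d x + \<beta> x \<bullet> gu x + c x * u x - f x) \<partial>?M)
      = (\<integral>x. sqrt \<epsilon> * (d x * \<phi> x) + (\<beta> x \<bullet> gu x + c x * u x) * \<phi> x - f x * \<phi> x \<partial>?M)"
    by (intro Bochner_Integration.integral_cong refl) (simp add: algebra_simps)
  also have "\<dots> = sqrt \<epsilon> * (\<integral>x. d x * \<phi> x \<partial>?M) + (\<integral>x. (\<beta> x \<bullet> gu x + c x * u x) * \<phi> x \<partial>?M) - (\<integral>x. f x * \<phi> x \<partial>?M)"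
    using L2_integrable_inner[OF L(3) P(1)] L2_integrable_inner[OF L1 P(1)] L2_integrable_inner[OF f P(1)]
    by (simp del: distrib_right_numeral)
  also have "\<dots> = 0" using 1 2 by simp
  finally show "(\<integral>x. \<phi> x * (sqrt \<epsilon> * d x + \<beta> x \<bullet> gu x + c x * u x - f x) \<partial>?M) = 0" .
qed

subsection \<open>Triangulations and the energy estimate\<close>

text \<open>Needed with \<open>S\<close> the open domain and \<open>K\<close> a closed triangle,
  which may protrude from it along the boundary.\<close>

lemma integrable_lebesgue_on_spike:
  fixes h :: "pt \<Rightarrow> real"
  assumes S: "S \<in> sets lebesgue" and K: "K \<in> sets lebesgue" and n: "negligible (K - S)"
    and h: "integrable (lebesgue_on S) h"
  shows "integrable (lebesgue_on K) h"
proof -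
  have "set_integrable lebesgue S h"
    using h S by (simp add: set_integrable_def integrable_restrict_space)
  then have "set_integrable lebesgue (K \<inter> S) h"
    by (rule set_integrable_subset) (use K S in auto)
  then have "set_integrable lebesgue K h"
    by (rule absolutely_integrable_spike_set) (auto intro: negligible_subset[OF n])
  then show ?thesis using K by (simp add: set_integrable_def integrable_restrict_space)
qed

lemma AE_lebesgue_on_spike:
  assumes S: "S \<in> sets lebesgue" and K: "K \<in> sets lebesgue" and n: "negligible (K - S)"
    and P: "AE x in lebesgue_on S. P x"
  shows "AE x in lebesgue_on K. P x"
proof -
  have "AE x in lebesgue. x \<in> S \<longrightarrow> P x" using P S by (subst (asm) AE_restrict_space_iff) auto
  moreover have "AE x in lebesgue. x \<notin> K - S"
    using n by (intro AE_not_in, simp only: negligible_iff_null_sets)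
  ultimately have "AE x in lebesgue. x \<in> K \<longrightarrow> P x" by eventually_elim auto
  then show ?thesis using K by (subst AE_restrict_space_iff) auto
qed

lemma triangle_compact_convex:
  assumes "triangle K" shows "compact K" "convex K"
proof -
  obtain a b c where K: "K = convex hull {a, b, c}" using assms unfolding triangle_def by blast
  show "compact K" unfolding K by (intro compact_convex_hull finite_imp_compact) simp
  show "convex K" unfolding K by (rule convex_convex_hull)
qed

lemma finite_vertices:
  assumes "triangle K" shows "finite (vertices K)" "card (vertices K) \<le> 3"
proof -
  obtain a b c where K: "K = convex hull {a, b, c}" using assms unfolding triangle_def by blast
  have sub: "vertices K \<subseteq> {a, b, c}"
    by (auto simp: K vertices_def dest!: extreme_point_of_convex_hull)
  then show "finite (vertices K)" by (rule finite_subset) simp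
  have "card (vertices K) \<le> card {a, b, c}" by (rule card_mono[OF _ sub]) simp
  also have "\<dots> \<le> 3" by (simp add: card_insert_if)
  finally show "card (vertices K) \<le> 3" .
qed

lemma convex_hull_vertices:
  assumes "triangle K" shows "convex hull (vertices K) = K"
  unfolding vertices_def
  by (rule Krein_Milman_Minkowski[OF triangle_compact_convex[OF assms], symmetric])

text \<open>Two distinct triangles share at most two vertices, for with three common ones both would
  be the hull of the same set. The hull of at most two points in the plane is convex with empty
  interior, hence null.\<close>

lemma triangulation_overlap_negligible:
  assumes T: "conf_triangulation \<Omega> T" and K: "K \<in> T" "K' \<in> T" "K \<noteq> K'"
  shows "negligible (K \<inter> K')"
proof -
  have tr: "triangle K" "triangle K'" and I: "K \<inter> K' = convex hull (vertices K \<inter> vertices K')"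
    using T K by (auto simp: conf_triangulation_def)
  let ?V = "vertices K \<inter> vertices K'"
  have fin: "finite ?V" using finite_vertices[OF tr(1)] by simp
  have "card ?V \<le> 2"
  proof (rule ccontr)
    assume "\<not> card ?V \<le> 2"
    then have "card (vertices K) \<le> card ?V" "card (vertices K') \<le> card ?V"
      using finite_vertices(2)[OF tr(1)] finite_vertices(2)[OF tr(2)] by linarith+
    then have "?V = vertices K" "?V = vertices K'"
      using card_seteq[OF finite_vertices(1)[OF tr(1)] Int_lower1]
        card_seteq[OF finite_vertices(1)[OF tr(2)] Int_lower2] by auto
    then show False
      using convex_hull_vertices[OF tr(1)] convex_hull_vertices[OF tr(2)] K(3) by metis
  qed
  then have "interior (convex hull ?V) = {}"
    using empty_interior_convex_hull[OF fin] by simp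
  then show ?thesis unfolding I by (simp add: negligible_convex_interior)
qed

lemma triangulation_element:
  assumes T: "conf_triangulation \<Omega> T" and \<Omega>: "convex \<Omega>" and K: "K \<in> T"
  shows "K \<in> sets lebesgue" "negligible (K - \<Omega>)"
proof -
  have "compact K" using T K triangle_compact_convex by (auto simp: conf_triangulation_def)
  then show "K \<in> sets lebesgue" by (simp add: compact_imp_closed borel_closed)
  have "K - \<Omega> \<subseteq> frontier \<Omega>"
    using T K interior_subset[of \<Omega>] by (auto simp: conf_triangulation_def frontier_def)
  then show "negligible (K - \<Omega>)"
    using negligible_convex_frontier[OF \<Omega>] negligible_subset by blast
qed

text \<open>Overlaps are null, so the integral is additive over elements. Their union is the closure
  of \<Omega>, which exceeds \<Omega> by the null frontier of a convex set.\<close>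

lemma sum_triangulation_integral:
  fixes h :: "pt \<Rightarrow> real"
  assumes T: "conf_triangulation \<Omega> T" and \<Omega>: "convex \<Omega>" "open \<Omega>" and h: "integrable (lebesgue_on \<Omega>) h"
  shows "(\<Sum>K\<in>T. integral\<^sup>L (lebesgue_on K) h) = integral\<^sup>L (lebesgue_on \<Omega>) h"
proof -
  note el = triangulation_element[OF T \<Omega>(1)]
  have \<Omega>m: "\<Omega> \<in> sets lebesgue" using \<Omega>(2) by auto
  have si: "set_integrable lebesgue K h" if "K \<in> sets lebesgue" "negligible (K - \<Omega>)" for K
    using integrable_lebesgue_on_spike[OF \<Omega>m that h] that(1)
    by (simp add: set_integrable_def integrable_restrict_space)
  have lo: "integral\<^sup>L (lebesgue_on K) h = (LINT x:K|lebesgue. h x)" if "K \<in> sets lebesgue" for K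
    using that by (simp add: set_lebesgue_integral_def integral_restrict_space)
  have U: "(\<Union>K\<in>T. K) = closure \<Omega>" "finite T" using T by (auto simp: conf_triangulation_def)
  have cn: "negligible (closure \<Omega> - \<Omega>)"
    using negligible_convex_frontier[OF \<Omega>(1)] \<Omega>(2) by (simp add: frontier_def interior_open)
  have cm: "closure \<Omega> \<in> sets lebesgue" by auto
  have "(\<Sum>K\<in>T. integral\<^sup>L (lebesgue_on K) h) = (\<Sum>K\<in>T. LINT x:K|lebesgue. h x)"
    using el lo by (intro sum.cong) auto
  also have "\<dots> = (LINT x:(\<Union>K\<in>T. K)|lebesgue. h x)"
  proof (rule set_integral_finite_UN_AE[symmetric, OF U(2)])
    fix K K' assume K: "K \<in> T" "K' \<in> T"
    show "AE x in lebesgue. x \<in> K \<and> x \<in> K' \<longrightarrow> K = K'"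
    proof (cases "K = K'")
      case False
      have "AE x in lebesgue. x \<notin> K \<inter> K'"
        using triangulation_overlap_negligible[OF T K False]
        by (intro AE_not_in, simp only: negligible_iff_null_sets)
      then show ?thesis by eventually_elim auto
    qed simp
  qed (use el si in auto)
  also have "\<dots> = (LINT x:\<Omega>|lebesgue. h x)"
    unfolding U set_lebesgue_integral_def
  proof (rule integral_cong_AE)
    have "AE x in lebesgue. x \<notin> closure \<Omega> - \<Omega>"
      using cn by (intro AE_not_in, simp only: negligible_iff_null_sets)
    then show "AE x in lebesgue. indicat_real (closure \<Omega>) x *\<^sub>R h x = indicat_real \<Omega> x *\<^sub>R h x"
      by eventually_elim (use closure_subset[of \<Omega>] in \<open>auto simp: indicator_def\<close>)
  qed (use si[OF cm cn] si[OF \<Omega>m] in \<open>auto simp: set_integrable_def dest!: borel_measurable_integrable\<close>)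
  finally show ?thesis using lo[OF \<Omega>m] by simp
qed

lemma sum_triangulation_l2norm:
  assumes "conf_triangulation \<Omega> T" "convex \<Omega>" "open \<Omega>" "L2 \<Omega> v"
  shows "(\<Sum>K\<in>T. (l2norm K v)\<^sup>2) = (l2norm \<Omega> v)\<^sup>2"
  unfolding l2norm_sq using assms by (intro sum_triangulation_integral) (auto simp: L2_def)

section \<open>Energy estimate and the two error bounds\<close>

lemma energy_estimate:
  assumes \<Omega>: "\<Omega> \<in> lmeasurable" and \<beta>: "W1inf_field \<Omega> \<beta> G" and c: "Linf \<Omega> c"
    and \<alpha>: "\<alpha> > 0" "AE x in lebesgue_on \<Omega>. c x - div_field G x / 2 \<ge> \<alpha>"
    and \<epsilon>: "\<epsilon> > 0" and E: "Hdiv \<Omega> E dE" and e: "H10 \<Omega> e ge"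
  shows "\<epsilon> * (l2norm \<Omega> ge)\<^sup>2 + \<alpha> * (l2norm \<Omega> e)\<^sup>2
    \<le> (l2norm \<Omega> (\<lambda>x. E x + sqrt \<epsilon> *\<^sub>R ge x))\<^sup>2
      + (l2norm \<Omega> (\<lambda>x. sqrt \<epsilon> * dE x + \<beta> x \<bullet> ge x + c x * e x))\<^sup>2 / \<alpha>"
proof -
  let ?M = "lebesgue_on \<Omega>"
  let ?A = "\<lambda>x. E x + sqrt \<epsilon> *\<^sub>R ge x" and ?B = "\<lambda>x. sqrt \<epsilon> * dE x + \<beta> x \<bullet> ge x + c x * e x"
  have b: "Linf \<Omega> \<beta>" using \<beta> by (simp add: W1inf_field_def)
  note d = Linf_div_field[OF \<beta>]
  have L: "L2 \<Omega> E" "L2 \<Omega> dE" "L2 \<Omega> e" "L2 \<Omega> ge" using E e by (auto simp: Hdiv_def H10_def)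
  have LA: "L2 \<Omega> ?A" by (intro L2_add L2_scaleR L)
  have Lb: "L2 \<Omega> (\<lambda>x. \<beta> x \<bullet> ge x)" and Lc: "L2 \<Omega> (\<lambda>x. c x * e x)" and Ld: "L2 \<Omega> (\<lambda>x. div_field G x * e x)"
    by (intro L2_inner_Linf L2_mult_Linf b c d L)+
  have LB: "L2 \<Omega> ?B" by (intro L2_add[OF L2_add] L2_mult Lb Lc L)
  note ii = L2_integrable_inner
  have "\<alpha> * (l2norm \<Omega> e)\<^sup>2 = (\<integral>x. \<alpha> * (norm (e x))\<^sup>2 \<partial>?M)" by (simp add: l2norm_sq)
  also have "\<dots> \<le> (\<integral>x. (c x * e x) \<bullet> e x - 1 / 2 * ((div_field G x * e x) \<bullet> e x) \<partial>?M)"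
  proof (rule integral_mono_AE)
    show "integrable ?M (\<lambda>x. \<alpha> * (norm (e x))\<^sup>2)" using L(3) by (simp add: L2_def)
    show "integrable ?M (\<lambda>x. (c x * e x) \<bullet> e x - 1 / 2 * ((div_field G x * e x) \<bullet> e x))"
      by (intro Bochner_Integration.integrable_diff integrable_mult_right ii Lc Ld L)
    show "AE x in ?M. \<alpha> * (norm (e x))\<^sup>2 \<le> (c x * e x) \<bullet> e x - 1 / 2 * ((div_field G x * e x) \<bullet> e x)"
      using \<alpha>(2)
    proof eventually_elim
      case (elim x)
      have "\<alpha> * (e x)\<^sup>2 \<le> (c x - div_field G x / 2) * (e x)\<^sup>2"
        by (rule mult_right_mono[OF elim]) simp
      then show ?case by (simp add: power2_eq_square algebra_simps)
    qed
  qed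
  also have "\<dots> = (\<integral>x. (c x * e x) \<bullet> e x \<partial>?M) - 1 / 2 * (\<integral>x. (div_field G x * e x) \<bullet> e x \<partial>?M)"
    by (subst Bochner_Integration.integral_diff)
      (use ii[OF Lc L(3)] ii[OF Ld L(3)] in \<open>simp_all\<close>)
  also have "\<dots> = (\<integral>x. (c x * e x) \<bullet> e x \<partial>?M) + (\<integral>x. (\<beta> x \<bullet> ge x) \<bullet> e x \<partial>?M)"
    using convection_skew[OF \<Omega> \<beta> e] by simp
  finally have 1: "\<alpha> * (l2norm \<Omega> e)\<^sup>2 \<le> (\<integral>x. (c x * e x) \<bullet> e x \<partial>?M) + (\<integral>x. (\<beta> x \<bullet> ge x) \<bullet> e x \<partial>?M)" .
  have "(\<integral>x. ?B x \<bullet> e x \<partial>?M) = (\<integral>x. sqrt \<epsilon> * (dE x \<bullet> e x) + (\<beta> x \<bullet> ge x) \<bullet> e x + (c x * e x) \<bullet> e x \<partial>?M)"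
    by (intro Bochner_Integration.integral_cong refl) (simp add: algebra_simps)
  also have "\<dots> = sqrt \<epsilon> * (\<integral>x. dE x \<bullet> e x \<partial>?M) + (\<integral>x. (\<beta> x \<bullet> ge x) \<bullet> e x \<partial>?M) + (\<integral>x. (c x * e x) \<bullet> e x \<partial>?M)"
    using ii[OF L(2,3)] ii[OF Lb L(3)] ii[OF Lc L(3)] by simp
  finally have 2: "(\<integral>x. ?B x \<bullet> e x \<partial>?M) = - (sqrt \<epsilon> * (\<integral>x. E x \<bullet> ge x \<partial>?M))
      + (\<integral>x. (\<beta> x \<bullet> ge x) \<bullet> e x \<partial>?M) + (\<integral>x. (c x * e x) \<bullet> e x \<partial>?M)"
    using Hdiv_H10_integration_by_parts[OF \<Omega> E e] by simp
  have "(\<integral>x. ?A x \<bullet> (sqrt \<epsilon> *\<^sub>R ge x) \<partial>?M) = (\<integral>x. sqrt \<epsilon> * (E x \<bullet> ge x) + \<epsilon> * (norm (ge x))\<^sup>2 \<partial>?M)"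
    using \<epsilon> by (intro Bochner_Integration.integral_cong refl)
      (simp add: inner_add_left power2_norm_eq_inner mult.assoc[symmetric] algebra_simps)
  also have "\<dots> = sqrt \<epsilon> * (\<integral>x. E x \<bullet> ge x \<partial>?M) + \<epsilon> * (l2norm \<Omega> ge)\<^sup>2"
    using ii[OF L(1,4)] L(4) by (simp add: l2norm_sq L2_def)
  finally have 3: "(\<integral>x. ?A x \<bullet> (sqrt \<epsilon> *\<^sub>R ge x) \<partial>?M) = sqrt \<epsilon> * (\<integral>x. E x \<bullet> ge x \<partial>?M) + \<epsilon> * (l2norm \<Omega> ge)\<^sup>2" .
  let ?a = "l2norm \<Omega> ?A" and ?b = "l2norm \<Omega> ?B"
  have "(\<integral>x. ?A x \<bullet> (sqrt \<epsilon> *\<^sub>R ge x) \<partial>?M) \<le> ?a * (sqrt \<epsilon> * l2norm \<Omega> ge)"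
    using l2norm_cauchy_schwarz[OF LA L2_scaleR[OF L(4), of "sqrt \<epsilon>"]] \<epsilon>
    unfolding l2norm_scaleR by (simp del: inner_scaleR_right)
  \<comment> \<open>Young with weight 1: of the two copies of
    \<open>\<epsilon> * (l2norm \<Omega> ge)\<^sup>2\<close> obtained after doubling, one survives
    on the left of the claim.\<close>
  also have "2 * \<dots> \<le> ?a\<^sup>2 + \<epsilon> * (l2norm \<Omega> ge)\<^sup>2"
    using sum_squares_bound[of ?a "sqrt \<epsilon> * l2norm \<Omega> ge"] \<epsilon> by (simp add: power_mult_distrib)
  finally have 4: "2 * (\<integral>x. ?A x \<bullet> (sqrt \<epsilon> *\<^sub>R ge x) \<partial>?M) \<le> ?a\<^sup>2 + \<epsilon> * (l2norm \<Omega> ge)\<^sup>2" by simp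
  have "(\<integral>x. ?B x \<bullet> e x \<partial>?M) \<le> ?b * l2norm \<Omega> e"
    using l2norm_cauchy_schwarz[OF LB L(3)] by simp
  \<comment> \<open>Young with weight \<alpha>: again exactly one copy of
    \<open>\<alpha> * (l2norm \<Omega> e)\<^sup>2\<close> survives, at the price of 1/\<alpha> on
    the residual.\<close>
  also have "2 * \<dots> \<le> ?b\<^sup>2 / \<alpha> + \<alpha> * (l2norm \<Omega> e)\<^sup>2"
    using sum_squares_bound[of "?b / sqrt \<alpha>" "sqrt \<alpha> * l2norm \<Omega> e"] \<alpha>(1)
    by (simp add: power_mult_distrib power_divide)
  finally have 5: "2 * (\<integral>x. ?B x \<bullet> e x \<partial>?M) \<le> ?b\<^sup>2 / \<alpha> + \<alpha> * (l2norm \<Omega> e)\<^sup>2" by simp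
  \<comment> \<open>Adding \<open>2\<close> and \<open>3\<close> cancels the pairing of
    \<open>E\<close> with \<open>ge\<close>. Twice the sum is bounded below through \<open>1\<close>
    and above by \<open>4\<close> and \<open>5\<close>.\<close>
  from 1 2 3 4 5 show ?thesis by argo
qed

text \<open>Parallelogram law: the two sides differ by the squared norm of a - b.\<close>

lemma norm_add_sq_le: "(norm (a + b))\<^sup>2 \<le> 2 * (norm a)\<^sup>2 + 2 * (norm (b :: 'a :: real_inner))\<^sup>2"
proof -
  have "0 \<le> (norm (a - b))\<^sup>2" by simp
  then show ?thesis by (simp add: power2_norm_eq_inner inner_add inner_diff inner_commute)
qed

text \<open>The hypotheses ask for integrable squares, the form in which \<open>on_K\<close>
  transfers information from \<Omega> to a triangle.\<close>

lemma l2norm_add_sq_le: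
  assumes "integrable (lebesgue_on S) (\<lambda>x. (norm (v x))\<^sup>2)" "integrable (lebesgue_on S) (\<lambda>x. (norm (w x))\<^sup>2)"
    "integrable (lebesgue_on S) (\<lambda>x. (norm (v x + w x))\<^sup>2)"
  shows "(l2norm S (\<lambda>x. v x + w x))\<^sup>2 \<le> 2 * (l2norm S v)\<^sup>2 + 2 * (l2norm S w)\<^sup>2"
proof -
  have "(l2norm S (\<lambda>x. v x + w x))\<^sup>2 \<le> (\<integral>x. 2 * (norm (v x))\<^sup>2 + 2 * (norm (w x))\<^sup>2 \<partial>lebesgue_on S)"
    unfolding l2norm_sq by (rule integral_mono[OF assms(3)]) (use assms norm_add_sq_le in auto)
  then show ?thesis using assms by (simp add: l2norm_sq)
qed

lemma convex_polygon_domain: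
  assumes "convex_polygon \<Omega>" shows "open \<Omega>" "convex \<Omega>" "\<Omega> \<in> lmeasurable"
proof -
  obtain P where P: "finite P" "\<Omega> = interior (convex hull P)" using assms by (auto simp: convex_polygon_def)
  then show o: "open \<Omega>" and "convex \<Omega>" by (auto intro: convex_interior)
  have "bounded (convex hull P)" using P(1) by (simp add: bounded_convex_hull finite_imp_bounded)
  then have "bounded \<Omega>" using P(2) interior_subset bounded_subset by metis
  then show "\<Omega> \<in> lmeasurable" using o by (simp add: lmeasurable_open)
qed

theorem theorem6p1:
  fixes \<Omega> :: "pt set" and \<beta> :: "pt \<Rightarrow> pt" and G\<beta> :: "2 \<Rightarrow> pt \<Rightarrow> pt"
    and c :: "pt \<Rightarrow> real" and \<gamma> \<alpha>0 :: real
  assumes "convex_polygon \<Omega>"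
    and "W1inf_field \<Omega> \<beta> G\<beta>"
    and "Linf \<Omega> c" and "AE x in lebesgue_on \<Omega>. \<bar>c x\<bar> \<le> \<gamma>"
    and "\<alpha>0 > 0"
    and "AE x in lebesgue_on \<Omega>. c x - div_field G\<beta> x / 2 \<ge> \<alpha>0"
  shows "\<exists>Ce Cr. Ce > 0 \<and> Cr > 0 \<and>
    (\<forall>(\<epsilon>::real) f u gu d\<sigma> T k \<sigma>h d\<sigma>h uh guh.
       0 < \<epsilon> \<and> \<epsilon> \<le> 1 \<and> L2 \<Omega> f \<and>
       weak_solution \<Omega> \<epsilon> \<beta> c f u gu \<and>
       Hdiv \<Omega> (\<lambda>x. - sqrt \<epsilon> *\<^sub>R gu x) d\<sigma> \<and>
       conf_triangulation \<Omega> T \<and>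
       U1h \<Omega> T k \<sigma>h d\<sigma>h uh guh
       \<longrightarrow>
       (let E = (\<lambda>x. (- sqrt \<epsilon> *\<^sub>R gu x) - \<sigma>h x);
            dE = (\<lambda>x. d\<sigma> x - d\<sigma>h x);
            e = (\<lambda>x. u x - uh x);
            ge = (\<lambda>x. gu x - guh x);
            \<eta>K = (\<lambda>K. sqrt (G1K \<epsilon> \<beta> c K \<sigma>h d\<sigma>h uh guh f))
        in (\<forall>K\<in>T. \<eta>K K \<le> Ce * sqrt (M1K \<epsilon> K E e ge
                                 + (l2norm K (\<lambda>x. \<beta> x \<bullet> ge x))\<^sup>2
                                 + \<epsilon> * (l2norm K dE)\<^sup>2))
         \<and> sqrt (\<Sum>K\<in>T. M1K \<epsilon> K E e ge) \<le> Cr * sqrt (\<Sum>K\<in>T. (\<eta>K K)\<^sup>2)))"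
proof -
  note dom = convex_polygon_domain[OF assms(1)]
  have \<Omega>m: "\<Omega> \<in> sets lebesgue" using dom(1) by auto
  have b: "Linf \<Omega> \<beta>" using assms(2) by (simp add: W1inf_field_def)
  \<comment> \<open>Splitting \<open>B\<close> twice gives coefficients 4, 4 and
    \<open>2 * \<gamma>\<^sup>2\<close>, and splitting \<open>A\<close> gives 2 and 2; each is at
    most \<open>4 + 4 * \<gamma>\<^sup>2\<close>. Both constants are fixed before \<epsilon>, the
    data and the mesh.\<close>
  define Ce where "Ce = sqrt (4 + 4 * \<gamma>\<^sup>2)"
  \<comment> \<open>With \<open>S\<close> the right-hand side of the energy estimate,
    \<open>E\<close> costs twice the first residual plus \<open>2 * S\<close>, the gradient costs
    \<open>S\<close> and \<open>e\<close> costs \<open>S / \<alpha>0\<close>. The last factor bounds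
    \<open>S\<close> by the squared estimator.\<close>
  define Cr where "Cr = sqrt (2 + (3 + 1 / \<alpha>0) * (1 + 1 / \<alpha>0))"
  have pos: "0 < 4 + 4 * \<gamma>\<^sup>2" "0 < 2 + (3 + 1 / \<alpha>0) * (1 + 1 / \<alpha>0)"
    using assms(5) by (intro add_pos_nonneg; simp)+
  have C: "Ce > 0" "Cr > 0" using pos by (simp_all add: Ce_def Cr_def)
  show ?thesis
  proof (rule exI[of _ Ce], rule exI[of _ Cr], intro conjI C allI impI, elim conjE)
    fix \<epsilon> :: real and f u gu d\<sigma> T k \<sigma>h d\<sigma>h uh guh
    assume \<epsilon>: "0 < \<epsilon>" "\<epsilon> \<le> 1" and f: "L2 \<Omega> f" and sol: "weak_solution \<Omega> \<epsilon> \<beta> c f u gu"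
      and \<sigma>: "Hdiv \<Omega> (\<lambda>x. - sqrt \<epsilon> *\<^sub>R gu x) d\<sigma>" and T: "conf_triangulation \<Omega> T"
      and U: "U1h \<Omega> T k \<sigma>h d\<sigma>h uh guh"
    define E where "E = (\<lambda>x. (- sqrt \<epsilon> *\<^sub>R gu x) - \<sigma>h x)"
    define dE where "dE = (\<lambda>x. d\<sigma> x - d\<sigma>h x)"
    define e where "e = (\<lambda>x. u x - uh x)"
    define ge where "ge = (\<lambda>x. gu x - guh x)"
    define A where "A = (\<lambda>x. E x + sqrt \<epsilon> *\<^sub>R ge x)"
    define B where "B = (\<lambda>x. sqrt \<epsilon> * dE x + \<beta> x \<bullet> ge x + c x * e x)"
    define r where "r = (\<lambda>x. sqrt \<epsilon> * d\<sigma>h x + \<beta> x \<bullet> guh x + c x * uh x - f x)"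
    have E: "Hdiv \<Omega> E dE" unfolding E_def dE_def
      using \<sigma> U by (intro Hdiv_diff) (auto simp: U1h_def)
    have e: "H10 \<Omega> e ge" unfolding e_def ge_def
      using sol U by (intro H10_diff[OF dom(3)]) (auto simp: weak_solution_def U1h_def)
    have L: "L2 \<Omega> E" "L2 \<Omega> dE" "L2 \<Omega> e" "L2 \<Omega> ge"
      using E e by (auto simp: Hdiv_def H10_def)
    have Lh: "L2 \<Omega> \<sigma>h" "L2 \<Omega> d\<sigma>h" "L2 \<Omega> uh" "L2 \<Omega> guh"
      using U by (auto simp: U1h_def Hdiv_def H10_def)
    have Lb: "L2 \<Omega> (\<lambda>x. \<beta> x \<bullet> ge x)" by (intro L2_inner_Linf b L)
    have Lc: "L2 \<Omega> (\<lambda>x. c x * e x)" by (intro L2_mult_Linf assms(3) L)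
    have LA: "L2 \<Omega> A" unfolding A_def by (intro L2_add L2_scaleR L)
    have LBd: "L2 \<Omega> (\<lambda>x. sqrt \<epsilon> * dE x)" by (intro L2_mult L)
    have LB: "L2 \<Omega> B" unfolding B_def by (intro L2_add[OF L2_add] LBd Lb Lc)
    have Lr: "L2 \<Omega> r" unfolding r_def
      by (intro L2_diff[OF L2_add[OF L2_add]] L2_mult L2_inner_Linf[OF b] L2_mult_Linf[OF assms(3)] Lh f)
    \<comment> \<open>The pointwise sum of \<open>r\<close> and \<open>B\<close> is the residual of
      the exact pair.\<close>
    have strong: "AE x in lebesgue_on \<Omega>. r x = - B x"
      using weak_solution_strong[OF dom(3,1) b assms(3) f \<epsilon>(1) sol \<sigma>]
      by eventually_elim (simp add: r_def B_def dE_def ge_def e_def inner_diff_right algebra_simps)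
    \<comment> \<open>The exact flux is by definition - sqrt \<epsilon> times the gradient, so this
      residual identity holds at every point, unlike \<open>strong\<close>.\<close>
    have sA: "(norm (\<sigma>h x + sqrt \<epsilon> *\<^sub>R guh x))\<^sup>2 = (norm (A x))\<^sup>2" for x
    proof -
      have "\<sigma>h x + sqrt \<epsilon> *\<^sub>R guh x = - A x" by (simp add: A_def E_def ge_def algebra_simps)
      then show ?thesis by simp
    qed
    have G: "G1K \<epsilon> \<beta> c K \<sigma>h d\<sigma>h uh guh f = (l2norm K A)\<^sup>2 + (l2norm K r)\<^sup>2" for K
      by (simp add: G1K_def r_def l2norm_sq sA)
    have on_K: "integrable (lebesgue_on K) (\<lambda>x. (norm (v x))\<^sup>2)" if "L2 \<Omega> v" "K \<in> T"
      for K and v :: "pt \<Rightarrow> 'z::euclidean_space"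
      using that integrable_lebesgue_on_spike[OF \<Omega>m triangulation_element[OF T dom(2)]]
      by (auto simp: L2_def)
    have local: "sqrt (G1K \<epsilon> \<beta> c K \<sigma>h d\<sigma>h uh guh f) \<le> Ce * sqrt (M1K \<epsilon> K E e ge
        + (l2norm K (\<lambda>x. \<beta> x \<bullet> ge x))\<^sup>2 + \<epsilon> * (l2norm K dE)\<^sup>2)" if K: "K \<in> T" for K
    proof -
      note AE_K = AE_lebesgue_on_spike[OF \<Omega>m triangulation_element[OF T dom(2) K]]
      have a: "(l2norm K A)\<^sup>2 \<le> 2 * (l2norm K E)\<^sup>2 + 2 * (\<epsilon> * (l2norm K ge)\<^sup>2)"
        using l2norm_add_sq_le[OF on_K[OF L(1) K] on_K[OF L2_scaleR[OF L(4)] K] on_K[OF LA[unfolded A_def] K]] \<epsilon>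
        by (simp add: A_def l2norm_scaleR power_mult_distrib)
      have "(l2norm K r)\<^sup>2 = (l2norm K B)\<^sup>2"
        unfolding l2norm_sq
      proof (rule integral_cong_AE)
        show "AE x in lebesgue_on K. (norm (r x))\<^sup>2 = (norm (B x))\<^sup>2"
          using AE_K[OF strong] by eventually_elim simp
      qed (use on_K[OF Lr K] on_K[OF LB K] in auto)
      also have "\<dots> \<le> 2 * (l2norm K (\<lambda>x. sqrt \<epsilon> * dE x + \<beta> x \<bullet> ge x))\<^sup>2 + 2 * (l2norm K (\<lambda>x. c x * e x))\<^sup>2"
        unfolding B_def
        by (rule l2norm_add_sq_le[OF on_K[OF L2_add[OF LBd Lb] K] on_K[OF Lc K] on_K[OF LB[unfolded B_def] K]])
      also have "(l2norm K (\<lambda>x. sqrt \<epsilon> * dE x + \<beta> x \<bullet> ge x))\<^sup>2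
          \<le> 2 * (\<epsilon> * (l2norm K dE)\<^sup>2) + 2 * (l2norm K (\<lambda>x. \<beta> x \<bullet> ge x))\<^sup>2"
        using l2norm_add_sq_le[OF on_K[OF LBd K] on_K[OF Lb K] on_K[OF L2_add[OF LBd Lb] K]]
          l2norm_scaleR[of K "sqrt \<epsilon>" dE] \<epsilon> by (simp add: power_mult_distrib)
      also have "(l2norm K (\<lambda>x. c x * e x))\<^sup>2 \<le> \<gamma>\<^sup>2 * (l2norm K e)\<^sup>2"
      proof -
        have "(l2norm K (\<lambda>x. c x * e x))\<^sup>2 \<le> (\<integral>x. \<gamma>\<^sup>2 * (norm (e x))\<^sup>2 \<partial>lebesgue_on K)"
          unfolding l2norm_sq
        proof (rule integral_mono_AE)
          show "AE x in lebesgue_on K. (norm (c x * e x))\<^sup>2 \<le> \<gamma>\<^sup>2 * (norm (e x))\<^sup>2"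
            using AE_K[OF assms(4)]
          proof eventually_elim
            case (elim x)
            have "(c x)\<^sup>2 \<le> \<gamma>\<^sup>2" using power_mono[OF elim abs_ge_zero, of 2] by simp
            then have "(c x)\<^sup>2 * (e x)\<^sup>2 \<le> \<gamma>\<^sup>2 * (e x)\<^sup>2" by (rule mult_right_mono) simp
            then show ?case by (simp add: power_mult_distrib)
          qed
        qed (use on_K[OF Lc K] on_K[OF L(3) K] in auto)
        then show ?thesis by (simp add: l2norm_sq)
      qed
      finally have "(l2norm K r)\<^sup>2 \<le> 4 * (\<epsilon> * (l2norm K dE)\<^sup>2) + 4 * (l2norm K (\<lambda>x. \<beta> x \<bullet> ge x))\<^sup>2
          + 2 * (\<gamma>\<^sup>2 * (l2norm K e)\<^sup>2)" by simp
      moreover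
      define s where "s = M1K \<epsilon> K E e ge + (l2norm K (\<lambda>x. \<beta> x \<bullet> ge x))\<^sup>2 + \<epsilon> * (l2norm K dE)\<^sup>2"
      have s: "s = (l2norm K E)\<^sup>2 + (l2norm K e)\<^sup>2 + \<epsilon> * (l2norm K ge)\<^sup>2
          + (l2norm K (\<lambda>x. \<beta> x \<bullet> ge x))\<^sup>2 + \<epsilon> * (l2norm K dE)\<^sup>2"
        by (simp add: s_def M1K_def)
      \<comment> \<open>Products with \<open>\<gamma>\<^sup>2\<close> are atoms for
        \<open>linarith\<close>, so their comparison is supplied beforehand.\<close>
      have "(l2norm K e)\<^sup>2 \<le> s"
        using \<epsilon>(1) by (simp add: s_def M1K_def)
      then have "\<gamma>\<^sup>2 * (l2norm K e)\<^sup>2 \<le> \<gamma>\<^sup>2 * s" by (rule mult_left_mono) simp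
      moreover have "0 \<le> \<epsilon> * (l2norm K ge)\<^sup>2" "0 \<le> \<epsilon> * (l2norm K dE)\<^sup>2" "0 \<le> \<gamma>\<^sup>2 * s" "0 \<le> (l2norm K E)\<^sup>2"
        "0 \<le> (l2norm K e)\<^sup>2"
        using \<epsilon>(1) by (simp_all add: s_def M1K_def)
      ultimately have "G1K \<epsilon> \<beta> c K \<sigma>h d\<sigma>h uh guh f \<le> (4 + 4 * \<gamma>\<^sup>2) * s"
        using a s unfolding G distrib_right mult.assoc by linarith
      then show ?thesis unfolding Ce_def s_def[symmetric] real_sqrt_mult[symmetric] by (rule real_sqrt_le_mono)
    qed
    have "(\<Sum>K\<in>T. M1K \<epsilon> K E e ge) \<le> (2 + (3 + 1 / \<alpha>0) * (1 + 1 / \<alpha>0)) * (\<Sum>K\<in>T. (sqrt (G1K \<epsilon> \<beta> c K \<sigma>h d\<sigma>h uh guh f))\<^sup>2)"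
    proof -
      note sm = sum_triangulation_l2norm[OF T dom(2,1)]
      define a2 where "a2 = (l2norm \<Omega> A)\<^sup>2"
      define b2 where "b2 = (l2norm \<Omega> B)\<^sup>2"
      define S where "S = a2 + b2 / \<alpha>0"
      have nn: "a2 \<ge> 0" "b2 \<ge> 0" "S \<ge> 0" using assms(5) by (simp_all add: a2_def b2_def S_def)
      have Mh: "(\<Sum>K\<in>T. M1K \<epsilon> K E e ge) = (l2norm \<Omega> E)\<^sup>2 + (l2norm \<Omega> e)\<^sup>2 + \<epsilon> * (l2norm \<Omega> ge)\<^sup>2"
        by (simp add: M1K_def sum.distrib sum_distrib_left[symmetric] sm L)
      have rB: "(l2norm \<Omega> r)\<^sup>2 = b2"
        unfolding l2norm_sq b2_def
      proof (rule integral_cong_AE)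
        show "AE x in lebesgue_on \<Omega>. (norm (r x))\<^sup>2 = (norm (B x))\<^sup>2"
          using strong by eventually_elim simp
      qed (use Lr LB in \<open>auto simp: L2_def\<close>)
      have "(\<Sum>K\<in>T. (sqrt (G1K \<epsilon> \<beta> c K \<sigma>h d\<sigma>h uh guh f))\<^sup>2) = (\<Sum>K\<in>T. (l2norm K A)\<^sup>2 + (l2norm K r)\<^sup>2)"
        by (intro sum.cong refl) (simp add: G)
      also have "\<dots> = a2 + b2" by (simp add: sum.distrib sm LA Lr rB a2_def)
      finally have eta: "(\<Sum>K\<in>T. (sqrt (G1K \<epsilon> \<beta> c K \<sigma>h d\<sigma>h uh guh f))\<^sup>2) = a2 + b2" .
      have en: "\<epsilon> * (l2norm \<Omega> ge)\<^sup>2 + \<alpha>0 * (l2norm \<Omega> e)\<^sup>2 \<le> S"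
        unfolding S_def a2_def b2_def A_def B_def
        by (rule energy_estimate[OF dom(3) assms(2,3,5,6) \<epsilon>(1) E e])
      have p: "0 \<le> \<alpha>0 * (l2norm \<Omega> e)\<^sup>2" "0 \<le> \<epsilon> * (l2norm \<Omega> ge)\<^sup>2"
        using assms(5) \<epsilon>(1) by simp_all
      have x: "\<epsilon> * (l2norm \<Omega> ge)\<^sup>2 \<le> S"
        using en p by linarith
      have "\<alpha>0 * (l2norm \<Omega> e)\<^sup>2 \<le> S"
        using en p by linarith
      then have y: "(l2norm \<Omega> e)\<^sup>2 \<le> 1 / \<alpha>0 * S" using assms(5) by (simp add: field_simps)
      have Ls: "L2 \<Omega> (\<lambda>x. (- sqrt \<epsilon>) *\<^sub>R ge x)" by (intro L2_scaleR L)
      have "E = (\<lambda>x. A x + (- sqrt \<epsilon>) *\<^sub>R ge x)" by (simp add: A_def)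
      then have "(l2norm \<Omega> E)\<^sup>2 = (l2norm \<Omega> (\<lambda>x. A x + (- sqrt \<epsilon>) *\<^sub>R ge x))\<^sup>2" by simp
      also have "\<dots> \<le> 2 * (l2norm \<Omega> A)\<^sup>2 + 2 * (l2norm \<Omega> (\<lambda>x. (- sqrt \<epsilon>) *\<^sub>R ge x))\<^sup>2"
        by (rule l2norm_add_sq_le) (use LA Ls L2_add[OF LA Ls] in \<open>simp_all only: L2_def\<close>)
      also have "\<dots> = 2 * a2 + 2 * (\<epsilon> * (l2norm \<Omega> ge)\<^sup>2)"
        unfolding l2norm_scaleR using \<epsilon> by (simp add: a2_def power_mult_distrib)
      finally have z: "(l2norm \<Omega> E)\<^sup>2 \<le> 2 * a2 + 2 * (\<epsilon> * (l2norm \<Omega> ge)\<^sup>2)" .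
      have "S \<le> (1 + 1 / \<alpha>0) * (a2 + b2)"
        using nn assms(5) divide_nonneg_pos[of a2 \<alpha>0] by (simp add: S_def algebra_simps add_divide_distrib)
      then have S: "(3 + 1 / \<alpha>0) * S \<le> (3 + 1 / \<alpha>0) * ((1 + 1 / \<alpha>0) * (a2 + b2))"
        using assms(5) by (intro mult_left_mono) simp_all
      have "(\<Sum>K\<in>T. M1K \<epsilon> K E e ge) \<le> 2 * (a2 + b2) + (3 * S + 1 / \<alpha>0 * S)"
        unfolding Mh using x y z nn(2) by argo
      also have "3 * S + 1 / \<alpha>0 * S = (3 + 1 / \<alpha>0) * S" by (rule distrib_right[symmetric])
      also have "2 * (a2 + b2) + (3 + 1 / \<alpha>0) * S \<le> 2 * (a2 + b2) + (3 + 1 / \<alpha>0) * ((1 + 1 / \<alpha>0) * (a2 + b2))"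
        by (rule add_left_mono[OF S])
      also have "\<dots> = (2 + (3 + 1 / \<alpha>0) * (1 + 1 / \<alpha>0)) * (a2 + b2)"
        by (simp only: distrib_right mult.assoc)
      finally show ?thesis unfolding eta .
    qed
    then have global: "sqrt (\<Sum>K\<in>T. M1K \<epsilon> K E e ge) \<le> Cr * sqrt (\<Sum>K\<in>T. (sqrt (G1K \<epsilon> \<beta> c K \<sigma>h d\<sigma>h uh guh f))\<^sup>2)"
      unfolding Cr_def real_sqrt_mult[symmetric] by (rule real_sqrt_le_mono)
    show "let E = (\<lambda>x. (- sqrt \<epsilon> *\<^sub>R gu x) - \<sigma>h x);
            dE = (\<lambda>x. d\<sigma> x - d\<sigma>h x);
            e = (\<lambda>x. u x - uh x);
            ge = (\<lambda>x. gu x - guh x);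
            \<eta>K = (\<lambda>K. sqrt (G1K \<epsilon> \<beta> c K \<sigma>h d\<sigma>h uh guh f))
        in (\<forall>K\<in>T. \<eta>K K \<le> Ce * sqrt (M1K \<epsilon> K E e ge
                                 + (l2norm K (\<lambda>x. \<beta> x \<bullet> ge x))\<^sup>2
                                 + \<epsilon> * (l2norm K dE)\<^sup>2))
         \<and> sqrt (\<Sum>K\<in>T. M1K \<epsilon> K E e ge) \<le> Cr * sqrt (\<Sum>K\<in>T. (\<eta>K K)\<^sup>2)"
      unfolding Let_def E_def[symmetric] dE_def[symmetric] e_def[symmetric] ge_def[symmetric]
      using local global by blast
  qed
qed

end
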